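(* Let $V\neq\{0\}$ be a Banach $\mathbb O$-bimodule and $T\in\mathscr B_{\mathcal{RO}}(V)$ power-associative. Then every $s\in\mathbb O$ with $|s|>\|T\|$ belongs to $\rho^*(T)$ (indeed to $\rho^*_J(T)$ for any $J$ with $s\in\mathbb C_J$), and for every $J\in\mathbb S$ the set $\sigma^*_J(T):=\mathbb C_J\setminus\rho_J^*(T)$ is a nonempty compact subset of $\mathbb C_J$.
   Context: $\mathbb O$ is the real octonion algebra with basis $e_0=1,\dots,e_7$, norm $|x|$; $\mathbb S=\{J\in\mathbb O:J^2=-1\}$, $\mathbb C_J=\mathbb R+\mathbb RJ$. An $\mathbb O$-bimodule is a real vector space $M$ with real-bilinear left and right multiplications by $\mathbb O$ (with $1x=x1=x$) whose associators $[p,q,x]=(pq)x-p(qx)$, $[p,x,q]=(px)q-p(xq)$, $[x,p,q]=(xp)q-x(pq)$ satisfy $[p,q,x]=[q,x,p]=[x,p,q]=-[q,p,x]$. Its real part is $\operatorname{Re}M=\{m: pm=mp,\ [p,q,m]=0\ \forall p,q\}$; $\operatorname{Re}x$ is the $e_0$-component in the unique decomposition $x=\sum e_ix_i$, $x_i\in\operatorname{Re}M$. A Banach $\mathbb O$-bimodule is one with a complete norm with $\|px\|=\|xp\|=|p|\|x\|$. $\mathscr B_{\mathbb R}(V)$: bounded real-linear operators with ordinary composition/powers; invertible means in $\mathscr B_{\mathbb R}(V)$; $R_sv=vs$. $\mathscr B_{\mathcal{RO}}(V)$: bounded real-linear $f$ with $\operatorname{Re}(f(x)p-f(xp))=0$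 for all $p,x$. $T$ is power-associative if $T^n\in\mathscr B_{\mathcal{RO}}(V)$ for all $n$. $S$ is $\mathbb C_J$-extendable power associative if $S^n(v\lambda)=S^n(v)\lambda$ for all $n\ge1,v\in\operatorname{Re}V,\lambda\in\mathbb C_J$. $\rho_J^*(T)=\{s\in\mathbb C_J: R_s-T$ invertible and $(R_s-T)^{-1}$ $\mathbb C_J$-extendable power associative$\}$, $\rho^*(T)=\bigcup_J\rho^*_J(T)$, pull-back spectrum $\sigma^*(T)=\mathbb O\setminus\rho^*(T)$. *)

theory Defs
  imports "HOL-Analysis.Analysis"
begin

section \<open>Octonions via the Cayley--Dickson construction\<close>

text \<open>Quaternions as pairs of complex numbers, octonions as pairs of quaternions.
 The real vector space and norm structures are those of the product type
 (Euclidean norm on R^8), which coincide with the octonion norm.\<close>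

type_synonym quat = "complex \<times> complex"
type_synonym oct = "quat \<times> quat"

fun qmult :: "quat \<Rightarrow> quat \<Rightarrow> quat" where
  "qmult (a, b) (c, d) = (a * c - cnj d * b, d * a + b * cnj c)"

fun qcnj :: "quat \<Rightarrow> quat" where
  "qcnj (a, b) = (cnj a, - b)"

fun omult :: "oct \<Rightarrow> oct \<Rightarrow> oct" (infixl "\<cdot>\<^sub>O" 70) where
  "omult (a, b) (c, d) = (qmult a c - qmult (qcnj d) b, qmult d a + qmult b (qcnj c))"

definition oone :: oct where
  "oone = ((1, 0), (0, 0))"

definition oe :: "nat \<Rightarrow> oct" where
  "oe i = (if i = 0 then ((1,0),(0,0)) else if i = 1 then ((\<i>,0),(0,0))
     else if i = 2 then ((0,1),(0,0)) else if i = 3 then ((0,\<i>),(0,0))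
     else if i = 4 then ((0,0),(1,0)) else if i = 5 then ((0,0),(\<i>,0))
     else if i = 6 then ((0,0),(0,1)) else ((0,0),(0,\<i>)))"

definition imag_units :: "oct set" ("\<S>") where
  "imag_units = {J. J \<cdot>\<^sub>O J = - oone}"

definition CJ :: "oct \<Rightarrow> oct set" where
  "CJ J = {a *\<^sub>R oone + b *\<^sub>R J | a b. True}"

text \<open>lm p x = p x (left multiplication), rm x p = x p (right multiplication).\<close>

definition assoc_l :: "(oct \<Rightarrow> 'v \<Rightarrow> 'v) \<Rightarrow> oct \<Rightarrow> oct \<Rightarrow> 'v \<Rightarrow> 'v::real_vector"
  where "assoc_l lm p q x = lm (p \<cdot>\<^sub>O q) x - lm p (lm q x)"

definition assoc_m :: "(oct \<Rightarrow> 'v \<Rightarrow> 'v) \<Rightarrow> ('v \<Rightarrow> oct \<Rightarrow> 'v) \<Rightarrow> oct \<Rightarrow> 'v \<Rightarrow> oct \<Rightarrow> 'v::real_vector"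
  where "assoc_m lm rm p x q = rm (lm p x) q - lm p (rm x q)"

definition assoc_r :: "('v \<Rightarrow> oct \<Rightarrow> 'v) \<Rightarrow> 'v \<Rightarrow> oct \<Rightarrow> oct \<Rightarrow> 'v::real_vector"
  where "assoc_r rm x p q = rm (rm x p) q - rm x (p \<cdot>\<^sub>O q)"

definition O_bimodule :: "(oct \<Rightarrow> 'v::real_vector \<Rightarrow> 'v) \<Rightarrow> ('v \<Rightarrow> oct \<Rightarrow> 'v) \<Rightarrow> bool" where
  "O_bimodule lm rm \<longleftrightarrow>
     bilinear lm \<and> bilinear rm \<and>
     (\<forall>x. lm oone x = x \<and> rm x oone = x) \<and>
     (\<forall>p q x. assoc_l lm p q x = assoc_m lm rm q x p
            \<and> assoc_m lm rm q x p = assoc_r rm x p q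
            \<and> assoc_r rm x p q = - assoc_l lm q p x)"

definition banach_O_bimodule :: "(oct \<Rightarrow> 'v::banach \<Rightarrow> 'v) \<Rightarrow> ('v \<Rightarrow> oct \<Rightarrow> 'v) \<Rightarrow> bool" where
  "banach_O_bimodule lm rm \<longleftrightarrow> O_bimodule lm rm \<and>
     (\<forall>p x. norm (lm p x) = norm p * norm x \<and> norm (rm x p) = norm p * norm x)"

definition ReM :: "(oct \<Rightarrow> 'v \<Rightarrow> 'v) \<Rightarrow> ('v \<Rightarrow> oct \<Rightarrow> 'v) \<Rightarrow> 'v::real_vector set" where
  "ReM lm rm = {m. (\<forall>p. lm p m = rm m p) \<and> (\<forall>p q. assoc_l lm p q m = 0)}"

definition ReV :: "(oct \<Rightarrow> 'v \<Rightarrow> 'v) \<Rightarrow> ('v \<Rightarrow> oct \<Rightarrow> 'v) \<Rightarrow> 'v \<Rightarrow> 'v::real_vector" where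
  "ReV lm rm x = (THE r. \<exists>xs. (\<forall>i<8. xs i \<in> ReM lm rm) \<and> xs 0 = r \<and>
                        x = (\<Sum>i<8. lm (oe i) (xs i)))"

definition B_RO :: "(oct \<Rightarrow> 'v \<Rightarrow> 'v) \<Rightarrow> ('v \<Rightarrow> oct \<Rightarrow> 'v) \<Rightarrow> ('v \<Rightarrow> 'v::real_normed_vector) \<Rightarrow> bool" where
  "B_RO lm rm f \<longleftrightarrow> bounded_linear f \<and>
     (\<forall>p x. ReV lm rm (rm (f x) p - f (rm x p)) = 0)"

definition power_assoc_op :: "(oct \<Rightarrow> 'v \<Rightarrow> 'v) \<Rightarrow> ('v \<Rightarrow> oct \<Rightarrow> 'v) \<Rightarrow> ('v \<Rightarrow> 'v::real_normed_vector) \<Rightarrow> bool" where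
  "power_assoc_op lm rm T \<longleftrightarrow> (\<forall>n. B_RO lm rm (T ^^ n))"

definition CJ_ext_pa :: "(oct \<Rightarrow> 'v \<Rightarrow> 'v) \<Rightarrow> ('v \<Rightarrow> oct \<Rightarrow> 'v) \<Rightarrow> oct \<Rightarrow> ('v \<Rightarrow> 'v::real_vector) \<Rightarrow> bool" where
  "CJ_ext_pa lm rm J S \<longleftrightarrow>
     (\<forall>n\<ge>1. \<forall>v\<in>ReM lm rm. \<forall>c\<in>CJ J. (S ^^ n) (rm v c) = rm ((S ^^ n) v) c)"

definition rho_J :: "(oct \<Rightarrow> 'v \<Rightarrow> 'v) \<Rightarrow> ('v \<Rightarrow> oct \<Rightarrow> 'v) \<Rightarrow> oct \<Rightarrow> ('v \<Rightarrow> 'v::real_normed_vector) \<Rightarrow> oct set" where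
  "rho_J lm rm J T = {s \<in> CJ J. bounded_linear (\<lambda>v. rm v s - T v) \<and>
      (\<exists>g. bounded_linear g \<and> g \<circ> (\<lambda>v. rm v s - T v) = id \<and> (\<lambda>v. rm v s - T v) \<circ> g = id
           \<and> CJ_ext_pa lm rm J g)}"

definition rho_star :: "(oct \<Rightarrow> 'v \<Rightarrow> 'v) \<Rightarrow> ('v \<Rightarrow> oct \<Rightarrow> 'v) \<Rightarrow> ('v \<Rightarrow> 'v::real_normed_vector) \<Rightarrow> oct set" where
  "rho_star lm rm T = (\<Union>J\<in>\<S>. rho_J lm rm J T)"

definition sigma_J :: "(oct \<Rightarrow> 'v \<Rightarrow> 'v) \<Rightarrow> ('v \<Rightarrow> oct \<Rightarrow> 'v) \<Rightarrow> oct \<Rightarrow> ('v \<Rightarrow> 'v::real_normed_vector) \<Rightarrow> oct set" where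
  "sigma_J lm rm J T = CJ J - rho_J lm rm J T"

end

(*
  A bimodule over the octonions is spanned by the products e_i n with n real. The left
  multiplications L_i by the imaginary units satisfy the Clifford relations, so the operators
  L_a L_b L_c, one for each line of the Fano plane, are commuting involutions. Multiplying a joint
  eigenvector by a suitable e_j makes all its eigenvalues equal to -1, and then it is real, or all
  equal to 1, and then the right multiplications force it to vanish. Consequently an operator in
  B_RO satisfies f(vp) = f(v)p for real v.

  Right multiplication by J turns V into a complex Banach space on which T is only real linear, but
  the x with T^n(xJ) = T^n(x)J for all n form a closed complex subspace containing Re V on which T
  acts complex linearly. Neumann series preserve such subspaces, so the resolvents they produce
  are again extendable; this gives the norm bound and the openness of the resolvent set. If the
  resolvent R(z) existed for all z, then z |-> R(z)v with v real and nonzero would be an entire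
  function vanishing at infinity. Its means over circles are independent of the radius, so
  R(0)v = 0, a contradiction.
*)
theory Submission
  imports Defs
begin

section \<open>Octonions\<close>


(* keeps the simplifier from rewriting oe 1 to oe (Suc 0), which oe_mult would not match *)
declare One_nat_def [simp del]

abbreviation re :: "oct \<Rightarrow> real" where "re a \<equiv> Re (fst (fst a))"

section \<open>Multiplication table and basic identities of the octonions\<close>

lemma bilinear_omult: "bilinear (\<cdot>\<^sub>O)"
  by (auto simp: bilinear_def algebra_simps scaleR_conv_of_real complex_cnj_add split_paired_all intro!: linearI)

lemma oone_eq: "oone = oe 0"
  by (simp add: oone_def oe_def)

lemma oct_basis_expansion:
  "p = re p *\<^sub>R oe 0 + Im (fst (fst p)) *\<^sub>R oe 1
     + Re (snd (fst p)) *\<^sub>R oe 2 + Im (snd (fst p)) *\<^sub>R oe 3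
     + Re (fst (snd p)) *\<^sub>R oe 4 + Im (fst (snd p)) *\<^sub>R oe 5
     + Re (snd (snd p)) *\<^sub>R oe 6 + Im (snd (snd p)) *\<^sub>R oe 7"
  by (cases p) (auto simp: oe_def complex_eq_iff)

lemma less_8_cases: "i < 8 \<longleftrightarrow> i \<in> {0, 1, 2, 3, 4, 5, 6, 7::nat}"
  by auto

lemma linear_eq_on_oe:
  fixes f g :: "oct \<Rightarrow> 'a::real_vector"
  assumes "linear f" "linear g" "\<And>i. i < 8 \<Longrightarrow> f (oe i) = g (oe i)"
  shows "f p = g p"
  using assms(3)
  by (subst (1 2) oct_basis_expansion)
     (simp add: less_8_cases linear_add[OF assms(1)] linear_add[OF assms(2)]
        linear_scale[OF assms(1)] linear_scale[OF assms(2)])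

lemma oe_mult:
  "oe 1 \<cdot>\<^sub>O oe 1 = - oe 0" "oe 1 \<cdot>\<^sub>O oe 2 = oe 3" "oe 1 \<cdot>\<^sub>O oe 3 = - oe 2" "oe 1 \<cdot>\<^sub>O oe 4 = oe 5"
    "oe 1 \<cdot>\<^sub>O oe 5 = - oe 4" "oe 1 \<cdot>\<^sub>O oe 6 = - oe 7" "oe 1 \<cdot>\<^sub>O oe 7 = oe 6"
  "oe 2 \<cdot>\<^sub>O oe 1 = - oe 3" "oe 2 \<cdot>\<^sub>O oe 2 = - oe 0" "oe 2 \<cdot>\<^sub>O oe 3 = oe 1" "oe 2 \<cdot>\<^sub>O oe 4 = oe 6"
    "oe 2 \<cdot>\<^sub>O oe 5 = oe 7" "oe 2 \<cdot>\<^sub>O oe 6 = - oe 4" "oe 2 \<cdot>\<^sub>O oe 7 = - oe 5"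
  "oe 3 \<cdot>\<^sub>O oe 1 = oe 2" "oe 3 \<cdot>\<^sub>O oe 2 = - oe 1" "oe 3 \<cdot>\<^sub>O oe 3 = - oe 0" "oe 3 \<cdot>\<^sub>O oe 4 = oe 7"
    "oe 3 \<cdot>\<^sub>O oe 5 = - oe 6" "oe 3 \<cdot>\<^sub>O oe 6 = oe 5" "oe 3 \<cdot>\<^sub>O oe 7 = - oe 4"
  "oe 4 \<cdot>\<^sub>O oe 1 = - oe 5" "oe 4 \<cdot>\<^sub>O oe 2 = - oe 6" "oe 4 \<cdot>\<^sub>O oe 3 = - oe 7" "oe 4 \<cdot>\<^sub>O oe 4 = - oe 0"
    "oe 4 \<cdot>\<^sub>O oe 5 = oe 1" "oe 4 \<cdot>\<^sub>O oe 6 = oe 2" "oe 4 \<cdot>\<^sub>O oe 7 = oe 3"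
  "oe 5 \<cdot>\<^sub>O oe 1 = oe 4" "oe 5 \<cdot>\<^sub>O oe 2 = - oe 7" "oe 5 \<cdot>\<^sub>O oe 3 = oe 6" "oe 5 \<cdot>\<^sub>O oe 4 = - oe 1"
    "oe 5 \<cdot>\<^sub>O oe 5 = - oe 0" "oe 5 \<cdot>\<^sub>O oe 6 = - oe 3" "oe 5 \<cdot>\<^sub>O oe 7 = oe 2"
  "oe 6 \<cdot>\<^sub>O oe 1 = oe 7" "oe 6 \<cdot>\<^sub>O oe 2 = oe 4" "oe 6 \<cdot>\<^sub>O oe 3 = - oe 5" "oe 6 \<cdot>\<^sub>O oe 4 = - oe 2"
    "oe 6 \<cdot>\<^sub>O oe 5 = oe 3" "oe 6 \<cdot>\<^sub>O oe 6 = - oe 0" "oe 6 \<cdot>\<^sub>O oe 7 = - oe 1"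
  "oe 7 \<cdot>\<^sub>O oe 1 = - oe 6" "oe 7 \<cdot>\<^sub>O oe 2 = oe 5" "oe 7 \<cdot>\<^sub>O oe 3 = oe 4" "oe 7 \<cdot>\<^sub>O oe 4 = - oe 3"
    "oe 7 \<cdot>\<^sub>O oe 5 = - oe 2" "oe 7 \<cdot>\<^sub>O oe 6 = oe 1" "oe 7 \<cdot>\<^sub>O oe 7 = - oe 0"
  by (simp_all add: oe_def zero_prod_def)

lemma oe_0_mult [simp]: "oe 0 \<cdot>\<^sub>O p = p" "p \<cdot>\<^sub>O oe 0 = p"
  by (cases p; cases "fst p"; cases "snd p"; simp add: oe_def)+

text \<open>Octonion associators are purely imaginary; \<open>real_projection_assoc_r\<close>
  carries this over to bimodules.\<close>

lemma re_omult_assoc: "re ((a \<cdot>\<^sub>O b) \<cdot>\<^sub>O c) = re (a \<cdot>\<^sub>O (b \<cdot>\<^sub>O c))"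
  by (cases a; cases b; cases c) (auto simp: algebra_simps)

text \<open>For imaginary units, e_i e_j e_i is e_j if i differs from j and -e_j if i = j, so the
  sum multiplies each e_j by 6 - 1 = 5 and 1 by -7. Subtracting it from 5 a removes the imaginary
  part and leaves 12 Re a.\<close>

lemma oct_real_part:
  "5 *\<^sub>R a - (\<Sum>i\<in>{1..7}. oe i \<cdot>\<^sub>O (a \<cdot>\<^sub>O oe i)) = (12 * re a) *\<^sub>R oone"
proof -
  have "{1..7} = {1,2,3,4,5,6,7::nat}" by auto
  then show ?thesis
    by (cases a) (auto simp: oe_def oone_def complex_eq_iff)
qed

lemma omult_self: "p \<cdot>\<^sub>O p = (2 * re p) *\<^sub>R p - (norm p)\<^sup>2 *\<^sub>R oone"
  by (cases p) (auto simp: norm_prod_def cmod_def complex_eq_iff oone_def power2_eq_square algebra_simps)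

section \<open>Octonionic bimodules\<close>

text \<open>Halving, in the two shapes in which doubled vectors occur below; a zero on the other
  side is written \<open>0 + 0\<close> to fit.\<close>

lemma double_eq_iff:
  fixes a b :: "'a::real_vector"
  shows "a + a = b + b \<longleftrightarrow> a = b" "- a - a = - b - b \<longleftrightarrow> a = b"
proof -
  show "a + a = b + b \<longleftrightarrow> a = b" by (metis scaleR_half_double)
  then show "- a - a = - b - b \<longleftrightarrow> a = b" by (metis minus_add_distrib minus_equation_iff uminus_add_conv_diff add_uminus_conv_diff)
qed

lemmas omult_simps = bilinear_ladd[OF bilinear_omult] bilinear_radd[OF bilinear_omult]
  bilinear_lsub[OF bilinear_omult] bilinear_rsub[OF bilinear_omult]
  bilinear_lneg[OF bilinear_omult] bilinear_rneg[OF bilinear_omult]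
  bilinear_lmul[OF bilinear_omult] bilinear_rmul[OF bilinear_omult]
  bilinear_lzero[OF bilinear_omult] bilinear_rzero[OF bilinear_omult]

declare omult_simps [simp]

text \<open>Every x is half the sum of x + f x and x - f x, eigenvectors for 1 and -1 that stay in
  the invariant subspace S. The eigenvalues appear as scalars so that eigenspaces with a sign
  parameter match.\<close>

lemma subset_by_involution:
  assumes S: "subspace S" and Q: "subspace Q" and f: "linear f"
    and invol: "\<And>x. f (f x) = x" and inv: "\<And>x. x \<in> S \<Longrightarrow> f x \<in> S"
    and plus: "\<And>x. x \<in> S \<Longrightarrow> f x = 1 *\<^sub>R x \<Longrightarrow> x \<in> Q"
    and minus: "\<And>x. x \<in> S \<Longrightarrow> f x = (-1) *\<^sub>R x \<Longrightarrow> x \<in> Q"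
  shows "S \<subseteq> Q"
proof
  fix x assume x: "x \<in> S"
  have "x + f x \<in> Q"
    by (rule plus) (use x S inv in \<open>auto simp: subspace_add linear_add[OF f] invol\<close>)
  moreover have "x - f x \<in> Q"
    by (rule minus) (use x S inv in \<open>auto simp: subspace_diff linear_diff[OF f] invol\<close>)
  ultimately have "(1/2) *\<^sub>R (x + f x) + (1/2) *\<^sub>R (x - f x) \<in> Q"
    by (meson Q subspace_add subspace_scale)
  also have "(1/2) *\<^sub>R (x + f x) + (1/2) *\<^sub>R (x - f x) = x"
    by (simp flip: scaleR_add_right)
  finally show "x \<in> Q" .
qed

locale oct_bimodule =
  fixes lm :: "oct \<Rightarrow> 'v::real_vector \<Rightarrow> 'v" and rm :: "'v \<Rightarrow> oct \<Rightarrow> 'v"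
  assumes bimodule: "O_bimodule lm rm"
begin

section \<open>Associator identities in a bimodule\<close>

lemma bilinear_lm: "bilinear lm" and bilinear_rm: "bilinear rm"
  using bimodule by (auto simp: O_bimodule_def)

lemmas lm_simps = bilinear_ladd[OF bilinear_lm] bilinear_radd[OF bilinear_lm]
  bilinear_lsub[OF bilinear_lm] bilinear_rsub[OF bilinear_lm]
  bilinear_lneg[OF bilinear_lm] bilinear_rneg[OF bilinear_lm]
  bilinear_lmul[OF bilinear_lm] bilinear_rmul[OF bilinear_lm]
  bilinear_lzero[OF bilinear_lm] bilinear_rzero[OF bilinear_lm]

lemmas rm_simps = bilinear_ladd[OF bilinear_rm] bilinear_radd[OF bilinear_rm]
  bilinear_lsub[OF bilinear_rm] bilinear_rsub[OF bilinear_rm]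
  bilinear_lneg[OF bilinear_rm] bilinear_rneg[OF bilinear_rm]
  bilinear_lmul[OF bilinear_rm] bilinear_rmul[OF bilinear_rm]
  bilinear_lzero[OF bilinear_rm] bilinear_rzero[OF bilinear_rm]

declare lm_simps [simp] rm_simps [simp]

lemma lm_oe_0 [simp]: "lm (oe 0) x = x" and rm_oe_0 [simp]: "rm x (oe 0) = x"
  using bimodule by (auto simp: O_bimodule_def oone_eq)

lemma assoc_m_eq: "assoc_m lm rm q x p = assoc_l lm p q x"
  and assoc_r_eq: "assoc_r rm x p q = assoc_l lm p q x"
  and assoc_l_swap: "assoc_l lm q p x = - assoc_l lm p q x"
  using bimodule unfolding O_bimodule_def by (metis minus_minus)+

text \<open>The correction term uses left multiplications only, so as a rewrite rule this pushes a
  right multiplication inwards until it meets the vector itself.\<close>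

lemma rm_lm: "rm (lm q x) p = lm q (rm x p) + (lm (p \<cdot>\<^sub>O q) x - lm p (lm q x))"
  using assoc_m_eq[of q x p] by (simp add: assoc_m_def assoc_l_def algebra_simps)

lemma rm_rm: "rm (rm x p) q = rm x (p \<cdot>\<^sub>O q) + (lm (p \<cdot>\<^sub>O q) x - lm p (lm q x))"
  using assoc_r_eq[of x p q] by (simp add: assoc_r_def assoc_l_def algebra_simps)

lemma lm_anticommutator: "lm p (lm q x) + lm q (lm p x) = lm (p \<cdot>\<^sub>O q + q \<cdot>\<^sub>O p) x"
  using assoc_l_swap[of p q x] by (simp add: assoc_l_def algebra_simps)

lemma lm_lm_same: "lm p (lm p x) = lm (p \<cdot>\<^sub>O p) x"
proof -
  have "assoc_l lm p p x + assoc_l lm p p x = 0 + 0"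
    using assoc_l_swap[of p p x] by (simp add: eq_neg_iff_add_eq_0)
  then have "assoc_l lm p p x = 0" by (simp only: double_eq_iff)
  then show ?thesis by (simp add: assoc_l_def)
qed

lemma rm_rm_same: "rm (rm x p) p = rm x (p \<cdot>\<^sub>O p)"
  by (simp add: rm_rm lm_lm_same)

section \<open>Clifford relations of the left multiplications L_i by e_i\<close>

lemma lm_oe_square:
  assumes "i \<in> {1..7}"
  shows "lm (oe i) (lm (oe i) x) = - x"
proof -
  have "i \<in> {1,2,3,4,5,6,7}" using assms by auto
  then show ?thesis by (auto simp: lm_lm_same oe_mult)
qed

lemma lm_oe_anticommute:
  assumes "i \<in> {1..7}" "j \<in> {1..7}" "i \<noteq> j"
  shows "lm (oe i) (lm (oe j) x) = - lm (oe j) (lm (oe i) x)"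
proof -
  have "i \<in> {1,2,3,4,5,6,7}" "j \<in> {1,2,3,4,5,6,7}" using assms by auto
  then have "oe i \<cdot>\<^sub>O oe j + oe j \<cdot>\<^sub>O oe i = 0"
    using \<open>i \<noteq> j\<close> by (auto simp: oe_mult)
  then show ?thesis
    using lm_anticommutator[of "oe i" "oe j" x] by (simp add: eq_neg_iff_add_eq_0)
qed

(* sorts products of the L_i in the order 1, 2, 4, 3, 5, 6, 7: in fano_uniform_reduce the last four
   are expressed through the first three, and this order moves them next to y *)
lemmas lm_oe_sort = lm_oe_square[of 1] lm_oe_square[of 2] lm_oe_square[of 3] lm_oe_square[of 4]
  lm_oe_square[of 5] lm_oe_square[of 6] lm_oe_square[of 7]
  lm_oe_anticommute[of 2 1] lm_oe_anticommute[of 4 1] lm_oe_anticommute[of 4 2]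
  lm_oe_anticommute[of 3 1] lm_oe_anticommute[of 3 2] lm_oe_anticommute[of 3 4]
  lm_oe_anticommute[of 5 1] lm_oe_anticommute[of 5 2] lm_oe_anticommute[of 5 4]
  lm_oe_anticommute[of 5 3] lm_oe_anticommute[of 6 1] lm_oe_anticommute[of 6 2]
  lm_oe_anticommute[of 6 4] lm_oe_anticommute[of 6 3] lm_oe_anticommute[of 6 5]
  lm_oe_anticommute[of 7 1] lm_oe_anticommute[of 7 2] lm_oe_anticommute[of 7 4]
  lm_oe_anticommute[of 7 3] lm_oe_anticommute[of 7 5] lm_oe_anticommute[of 7 6]

text \<open>Write d for [p,q,x]. Multiplying qx twice by p on the right gives [p,q,xp] = -dp, as
  both squares are -1. Expanding d and moving p inwards gives dp = [p,q,xp] + [p,pq,x] - pd, where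
  [p,pq,x] = -pd. Together 2 dp = -2 pd.\<close>

lemma rm_assoc_l:
  assumes "p \<cdot>\<^sub>O p = - oone" "p \<cdot>\<^sub>O (p \<cdot>\<^sub>O q) = - q"
  shows "rm (assoc_l lm p q x) p = - lm p (assoc_l lm p q x)"
proof -
  have pp: "lm p (lm p y) = - y" "rm (rm y p) p = - y" for y
    using assms(1) by (simp_all add: lm_lm_same rm_rm_same oone_eq)
  have pR: "rm (lm p y) p = lm p (rm y p)" for y
    by (simp add: rm_lm lm_lm_same)
  have D: "rm (lm q y) p = lm q (rm y p) + assoc_l lm p q y" for q y
    by (simp add: rm_lm assoc_l_def)
  have "rm (rm (lm q x) p) p = lm q (rm (rm x p) p) + assoc_l lm p q (rm x p) + rm (assoc_l lm p q x) p"
    by (simp add: D)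
  then have 1: "assoc_l lm p q (rm x p) = - rm (assoc_l lm p q x) p"
    by (simp add: pp eq_neg_iff_add_eq_0)
  have "rm (assoc_l lm p q x) p = rm (lm (p \<cdot>\<^sub>O q) x) p - lm p (rm (lm q x) p)"
    by (simp add: assoc_l_def pR)
  also have "\<dots> = assoc_l lm p q (rm x p) + assoc_l lm p (p \<cdot>\<^sub>O q) x - lm p (assoc_l lm p q x)"
    by (simp add: D assoc_l_def[of lm p q "rm x p"])
  finally have "rm (assoc_l lm p q x) p = \<dots>" .
  moreover have "assoc_l lm p (p \<cdot>\<^sub>O q) x = - lm p (assoc_l lm p q x)"
    by (simp add: assoc_l_def pp assms(2))
  ultimately have "2 *\<^sub>R rm (assoc_l lm p q x) p = 2 *\<^sub>R (- lm p (assoc_l lm p q x))"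
    unfolding scaleR_2 using 1 by (simp add: eq_diff_eq eq_neg_iff_add_eq_0 add_ac)
  then show ?thesis by (simp only: scaleR_cancel_left) simp
qed

section \<open>Fano involutions and vectors on which they all have the same eigenvalue\<close>

definition fano_product :: "nat \<Rightarrow> nat \<Rightarrow> nat \<Rightarrow> 'v \<Rightarrow> 'v" where
  "fano_product a b c x = lm (oe a) (lm (oe b) (lm (oe c) x))"

text \<open>Since L_b L_a L_a L_b is the identity, the equation of a line can be solved for L_c y.
  This leaves only L_1, L_2 and L_4, whose units generate the octonions.\<close>

lemma fano_uniform_reduce:
  assumes "fano_product 1 2 3 y = s *\<^sub>R y" "fano_product 1 4 5 y = s *\<^sub>R y"
    "fano_product 2 4 6 y = s *\<^sub>R y" "fano_product 3 4 7 y = s *\<^sub>R y" and "s \<in> {1, -1}"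
  shows "lm (oe 3) y = - s *\<^sub>R lm (oe 1) (lm (oe 2) y)"
    "lm (oe 5) y = - s *\<^sub>R lm (oe 1) (lm (oe 4) y)"
    "lm (oe 6) y = - s *\<^sub>R lm (oe 2) (lm (oe 4) y)"
    "lm (oe 7) y = - lm (oe 1) (lm (oe 2) (lm (oe 4) y))"
proof -
  have pair: "lm (oe c) y = s *\<^sub>R lm (oe b) (lm (oe a) y)"
    if "fano_product a b c y = s *\<^sub>R y" "a \<in> {1..7}" "b \<in> {1..7}" for a b c
  proof -
    have "lm (oe b) (lm (oe a) (fano_product a b c y)) = lm (oe c) y"
      using that(2,3) by (simp add: fano_product_def lm_oe_square)
    with that(1) show ?thesis by simp
  qed
  show 3: "lm (oe 3) y = - s *\<^sub>R lm (oe 1) (lm (oe 2) y)"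
    using pair[OF assms(1)] by (simp add: lm_oe_sort)
  show "lm (oe 5) y = - s *\<^sub>R lm (oe 1) (lm (oe 4) y)"
    using pair[OF assms(2)] by (simp add: lm_oe_sort)
  show "lm (oe 6) y = - s *\<^sub>R lm (oe 2) (lm (oe 4) y)"
    using pair[OF assms(3)] by (simp add: lm_oe_sort)
  have "lm (oe 7) y = s *\<^sub>R lm (oe 4) (lm (oe 3) y)"
    using pair[OF assms(4)] by simp
  \<comment> \<open>Substituting for L_3 brings in a second factor s, and s * s = 1.\<close>
  then show "lm (oe 7) y = - lm (oe 1) (lm (oe 2) (lm (oe 4) y))"
    using assms(5) by (auto simp: 3 lm_oe_sort)
qed

text \<open>Left multiplications alone allow such vectors: 1 is one if p acts on the octonions as
  left multiplication by its conjugate. The right action excludes them: y is half of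
  [e_2, e_1, e_3 y], so \<open>rm_assoc_l\<close> determines y e_2, and then two evaluations of (e_5
  y) e_2 differ in sign.\<close>

lemma fano_all_plus_imp_zero:
  assumes "fano_product 1 2 3 y = 1 *\<^sub>R y" "fano_product 1 4 5 y = 1 *\<^sub>R y"
    "fano_product 2 4 6 y = 1 *\<^sub>R y" "fano_product 3 4 7 y = 1 *\<^sub>R y"
  shows "y = 0"
proof -
  note red = fano_uniform_reduce[OF assms, simplified]
  have "assoc_l lm (oe 2) (oe 1) (lm (oe 3) y) = - 2 *\<^sub>R (- y)"
    by (simp add: assoc_l_def oe_mult red lm_oe_sort scaleR_2)
  then have "2 *\<^sub>R rm y (oe 2) = 2 *\<^sub>R (- lm (oe 2) y)"
    using rm_assoc_l[of "oe 2" "oe 1" "lm (oe 3) y"] by (simp add: oe_mult oone_eq)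
  then have R2: "rm y (oe 2) = - lm (oe 2) y" by (simp only: scaleR_cancel_left) simp
  (* (e_1 (e_4 y)) e_2 and (e_5 y) e_2 come out equal although e_1 (e_4 y) = - e_5 y *)
  have "rm (lm (oe 1) (lm (oe 4) y)) (oe 2) = - lm (oe 1) (lm (oe 2) (lm (oe 4) y))"
    by (simp add: rm_lm R2 oe_mult red lm_oe_sort)
  moreover have "rm (lm (oe 5) y) (oe 2) = - lm (oe 1) (lm (oe 2) (lm (oe 4) y))"
    unfolding rm_lm[of "oe 5"] by (simp add: R2 oe_mult red lm_oe_sort)
  ultimately have "lm (oe 1) (lm (oe 2) (lm (oe 4) y)) = - lm (oe 1) (lm (oe 2) (lm (oe 4) y))"
    by (simp add: red)
  then have "lm (oe 1) (lm (oe 2) (lm (oe 4) y)) + lm (oe 1) (lm (oe 2) (lm (oe 4) y)) = 0 + 0"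
    by (simp add: eq_neg_iff_add_eq_0)
  then have "lm (oe 1) (lm (oe 2) (lm (oe 4) y)) = 0"
    by (simp only: double_eq_iff)
  then have "lm (oe 4) (lm (oe 2) (lm (oe 1) (lm (oe 1) (lm (oe 2) (lm (oe 4) y))))) = 0"
    by simp
  then show ?thesis by (simp add: lm_oe_sort)
qed

section \<open>Vectors with vanishing associators are real\<close>

lemma assoc_l_eq_0_on_oe:
  assumes "\<And>i j. i < 8 \<Longrightarrow> j < 8 \<Longrightarrow> assoc_l lm (oe i) (oe j) y = 0"
  shows "assoc_l lm p q y = 0"
proof -
  have lin: "linear (\<lambda>p. assoc_l lm p q y)" "linear (\<lambda>q. assoc_l lm p q y)" for p q
    unfolding assoc_l_def
    by (intro linearI; simp add: algebra_simps)+
  have z: "linear (\<lambda>p::oct. 0::'v)" by (simp add: linear_iff)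
  have "assoc_l lm (oe i) q y = 0" if "i < 8" for i
    using linear_eq_on_oe[OF lin(2) z] assms that by blast
  then show ?thesis using linear_eq_on_oe[OF lin(1) z] by blast
qed

(* both [p,q,r] y and y [p,q,r] equal [p,q,yr], and every imaginary e_i is half an associator *)
lemma nucleus_commutes:
  assumes D: "\<And>p q. assoc_l lm p q y = 0"
  shows "lm p y = rm y p"
proof -
  have LL: "lm p (lm q y) = lm (p \<cdot>\<^sub>O q) y" for p q
    using D[of p q] by (simp add: assoc_l_def)
  have RR: "rm (rm y p) q = rm y (p \<cdot>\<^sub>O q)" for p q
    using D[of p q] by (simp add: rm_rm LL)
  have LR: "rm (lm q y) p = lm q (rm y p)" for p q
    using D[of p q] by (simp add: rm_lm LL)
  have key: "lm ((r \<cdot>\<^sub>O p) \<cdot>\<^sub>O q - r \<cdot>\<^sub>O (p \<cdot>\<^sub>O q)) y = rm y ((r \<cdot>\<^sub>O p) \<cdot>\<^sub>O q - r \<cdot>\<^sub>O (p \<cdot>\<^sub>O q))" for p q r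
  proof -
    have "assoc_l lm p q (rm y r) = lm (p \<cdot>\<^sub>O q) (rm y r) - lm p (lm q (rm y r))"
      by (simp add: assoc_l_def)
    also have "\<dots> = rm (lm (p \<cdot>\<^sub>O q) y) r - lm p (rm (lm q y) r)" by (simp add: LR)
    also have "\<dots> = rm (lm (p \<cdot>\<^sub>O q) y) r - (rm (lm p (lm q y)) r - (lm (r \<cdot>\<^sub>O p) (lm q y) - lm r (lm p (lm q y))))"
      by (simp add: rm_lm[of p "lm q y" r])
    also have "\<dots> = lm ((r \<cdot>\<^sub>O p) \<cdot>\<^sub>O q - r \<cdot>\<^sub>O (p \<cdot>\<^sub>O q)) y" by (simp add: LL)
    finally have 1: "assoc_l lm p q (rm y r) = lm ((r \<cdot>\<^sub>O p) \<cdot>\<^sub>O q - r \<cdot>\<^sub>O (p \<cdot>\<^sub>O q)) y" .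
    have "assoc_l lm p q (rm y r) = rm (rm (rm y r) p) q - rm (rm y r) (p \<cdot>\<^sub>O q)"
      using assoc_r_eq[of "rm y r" p q] by (simp add: assoc_r_def)
    with 1 show ?thesis by (simp add: RR)
  qed
  have "lm (oe i) y = rm y (oe i)" if "i < 8" for i
  proof -
    have "lm (oe 1) y = rm y (oe 1)" "lm (oe 2) y = rm y (oe 2)" "lm (oe 3) y = rm y (oe 3)"
      "lm (oe 4) y = rm y (oe 4)" "lm (oe 5) y = rm y (oe 5)" "lm (oe 6) y = rm y (oe 6)"
      "lm (oe 7) y = rm y (oe 7)"
      using key[of "oe 2" "oe 4" "oe 7"] key[of "oe 1" "oe 4" "oe 7"] key[of "oe 1" "oe 4" "oe 6"]
        key[of "oe 1" "oe 2" "oe 7"] key[of "oe 1" "oe 2" "oe 6"] key[of "oe 1" "oe 2" "oe 5"]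
        key[of "oe 1" "oe 2" "oe 4"]
      by (simp_all add: oe_mult double_eq_iff)
    with \<open>i < 8\<close> show ?thesis
      by (auto simp: less_8_cases)
  qed
  then show ?thesis
    by (rule linear_eq_on_oe[where f="\<lambda>p. lm p y" and g="rm y", rotated 2])
      (assumption | (rule linearI, simp, simp))+
qed

text \<open>On a real vector a line acts as e_a (e_b e_c) = e_a e_a = -1, so -1 is the expected
  eigenvalue. Conversely, the reductions now read e_3 y = e_1 (e_2 y) and so on, with the signs of
  the multiplication table, so all basis associators vanish at y.\<close>

lemma fano_all_minus_imp_ReM:
  assumes "fano_product 1 2 3 y = (-1) *\<^sub>R y" "fano_product 1 4 5 y = (-1) *\<^sub>R y"
    "fano_product 2 4 6 y = (-1) *\<^sub>R y" "fano_product 3 4 7 y = (-1) *\<^sub>R y"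
  shows "y \<in> ReM lm rm"
proof -
  note red = fano_uniform_reduce[OF assms, simplified]
  have "assoc_l lm (oe i) (oe j) y = 0" if "i < 8" "j < 8" for i j
    using that by (auto simp: less_8_cases assoc_l_def oe_mult red lm_oe_sort)
  then have "assoc_l lm p q y = 0" for p q by (rule assoc_l_eq_0_on_oe)
  then show ?thesis using nucleus_commutes by (auto simp: ReM_def)
qed

section \<open>Decomposition of the bimodule into real components\<close>

lemma subspace_ReM: "subspace (ReM lm rm)"
  unfolding subspace_def ReM_def assoc_l_def
  by (auto simp: algebra_simps)

lemma ReM_commute: "n \<in> ReM lm rm \<Longrightarrow> rm n p = lm p n"
  and ReM_lm_lm: "n \<in> ReM lm rm \<Longrightarrow> lm p (lm q n) = lm (p \<cdot>\<^sub>O q) n"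
proof -
  assume "n \<in> ReM lm rm"
  then have "(\<forall>p. lm p n = rm n p) \<and> (\<forall>p q. assoc_l lm p q n = 0)"
    unfolding ReM_def mem_Collect_eq .
  then show "rm n p = lm p n" "lm p (lm q n) = lm (p \<cdot>\<^sub>O q) n"
    unfolding assoc_l_def by (metis, metis eq_iff_diff_eq_0)
qed

lemma ReM_rm_lm: "n \<in> ReM lm rm \<Longrightarrow> rm (lm q n) p = lm (q \<cdot>\<^sub>O p) n"
  by (simp add: rm_lm ReM_commute ReM_lm_lm)

definition real_components :: "'v set" where
  "real_components = {x. \<exists>xs. (\<forall>i<8. xs i \<in> ReM lm rm) \<and> x = (\<Sum>i<8. lm (oe i) (xs i))}"

lemma subspace_real_components: "subspace real_components"
  unfolding subspace_def
proof (intro conjI ballI allI)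
  show "0 \<in> real_components"
    unfolding real_components_def using subspace_0[OF subspace_ReM]
    by (auto intro!: exI[of _ "\<lambda>_. 0"])
next
  fix x y assume "x \<in> real_components" "y \<in> real_components"
  then obtain xs ys where xs: "\<forall>i<8. xs i \<in> ReM lm rm" "x = (\<Sum>i<8. lm (oe i) (xs i))"
    and ys: "\<forall>i<8. ys i \<in> ReM lm rm" "y = (\<Sum>i<8. lm (oe i) (ys i))"
    unfolding real_components_def by auto
  then show "x + y \<in> real_components"
    unfolding real_components_def
    by (auto intro!: exI[of _ "\<lambda>i. xs i + ys i"] subspace_add[OF subspace_ReM] simp: sum.distrib)
next
  fix c x assume "x \<in> real_components"
  then obtain xs where "\<forall>i<8. xs i \<in> ReM lm rm" "x = (\<Sum>i<8. lm (oe i) (xs i))"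
    unfolding real_components_def by auto
  then show "c *\<^sub>R x \<in> real_components"
    unfolding real_components_def
    by (auto intro!: exI[of _ "\<lambda>i. c *\<^sub>R xs i"] subspace_scale[OF subspace_ReM] simp: scaleR_sum_right)
qed

lemma lm_oe_ReM_in_real_components:
  assumes "n \<in> ReM lm rm" "j < 8"
  shows "lm (oe j) n \<in> real_components"
proof -
  have "(\<Sum>i<8. lm (oe i) (if i = j then n else 0)) = (\<Sum>i<8. if i = j then lm (oe i) n else 0)"
    by (intro sum.cong) auto
  also have "\<dots> = lm (oe j) n" using assms by simp
  finally show ?thesis
    unfolding real_components_def using assms subspace_0[OF subspace_ReM]
    by (auto intro!: exI[of _ "\<lambda>i. if i = j then n else 0"])
qed

text \<open>Multiplying e_j x once more by e_j gives back x up to sign.\<close>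

lemma fano_uniform_in_real_components:
  assumes "fano_product 1 2 3 (lm (oe j) x) = s *\<^sub>R lm (oe j) x"
    "fano_product 1 4 5 (lm (oe j) x) = s *\<^sub>R lm (oe j) x"
    "fano_product 2 4 6 (lm (oe j) x) = s *\<^sub>R lm (oe j) x"
    "fano_product 3 4 7 (lm (oe j) x) = s *\<^sub>R lm (oe j) x"
    and s: "s \<in> {1, -1}" and j: "j < 8"
  shows "x \<in> real_components"
proof (cases "s = 1")
  case True
  then have y: "lm (oe j) x = 0"
    using assms(1-4) fano_all_plus_imp_zero by blast
  have "lm (oe j) (lm (oe j) x) \<in> real_components"
    using subspace_0[OF subspace_real_components] by (simp add: y)
  then show ?thesis
    using j lm_oe_square[of j x] subspace_neg[OF subspace_real_components, of "- x"] y
    by (cases "j = 0") auto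
next
  case False
  then have y: "lm (oe j) x \<in> ReM lm rm"
    using s assms(1-4) fano_all_minus_imp_ReM by blast
  show ?thesis
    using lm_oe_ReM_in_real_components[OF y j] lm_oe_ReM_in_real_components[OF y, of 0] j
      lm_oe_square[of j x] subspace_neg[OF subspace_real_components, of "- x"]
    by (cases "j = 0") auto
qed

text \<open>L_j commutes with the product along a line through j and anticommutes with the others,
  so passing from x to e_j x flips exactly the signs of the lines that miss j.\<close>

lemma fano_eigenvector_in_real_components:
  assumes "fano_product 1 2 3 x = a *\<^sub>R x" "fano_product 1 4 5 x = b *\<^sub>R x"
    "fano_product 2 4 6 x = c *\<^sub>R x" "fano_product 3 4 7 x = d *\<^sub>R x"
    and "a \<in> {1, -1}" "b \<in> {1, -1}" "c \<in> {1, -1}" "d \<in> {1, -1}"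
  shows "x \<in> real_components"
proof -
  have comm: "fano_product p q r (lm (oe j) x) = ((if j \<in> {0, p, q, r} then 1 else -1) * t) *\<^sub>R lm (oe j) x"
    if "(p, q, r) \<in> {(1,2,3),(1,4,5),(2,4,6),(3,4,7)}" "j < 8" "fano_product p q r x = t *\<^sub>R x"
    for p q r j t
  proof -
    have "fano_product p q r (lm (oe j) x)
        = (if j \<in> {0, p, q, r} then 1 else -1) *\<^sub>R lm (oe j) (fano_product p q r x)"
      using that(1,2) by (auto simp: less_8_cases fano_product_def lm_oe_sort)
    then show ?thesis by (simp add: that(3))
  qed
  have scaled: "x \<in> real_components" if "j < 8" "s \<in> {1, -1}"
    "(if j \<in> {0,1,2,3} then 1 else -1) * a = s" "(if j \<in> {0,1,4,5} then 1 else -1) * b = s"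
    "(if j \<in> {0,2,4,6} then 1 else -1) * c = s" "(if j \<in> {0,3,4,7} then 1 else -1) * d = s"
    for j :: nat and s
    by (rule fano_uniform_in_real_components
        [OF comm[OF _ that(1) assms(1), unfolded that(3)] comm[OF _ that(1) assms(2), unfolded that(4)]
          comm[OF _ that(1) assms(3), unfolded that(5)] comm[OF _ that(1) assms(4), unfolded that(6)]])
      (use that(1,2) in simp_all)
  \<comment> \<open>Up to a common sign, the flips by e_0, ..., e_7 realise each of the eight sign
    patterns relative to a once. The case with number k uses e_k; the resulting uniform eigenvalue
    is a for k = 0 and for k on the first line, and -a otherwise.\<close>
  consider (z0) "b = a" "c = a" "d = a"
    | (z1) "b = a" "c = - a" "d = - a"
    | (z2) "b = - a" "c = a" "d = - a"
    | (z3) "b = - a" "c = - a" "d = a"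
    | (z4) "b = - a" "c = - a" "d = - a"
    | (z5) "b = - a" "c = a" "d = a"
    | (z6) "b = a" "c = - a" "d = a"
    | (z7) "b = a" "c = a" "d = - a"
    using assms(5-8) by auto
  then show ?thesis
  proof cases
    case z0
    then show ?thesis using scaled[of 0 a] assms(5) by auto
  next
    case z1
    then show ?thesis using scaled[of 1 a] assms(5) by auto
  next
    case z2
    then show ?thesis using scaled[of 2 a] assms(5) by auto
  next
    case z3
    then show ?thesis using scaled[of 3 a] assms(5) by auto
  next
    case z4
    then show ?thesis using scaled[of 4 "- a"] assms(5) by auto
  next
    case z5
    then show ?thesis using scaled[of 5 "- a"] assms(5) by auto
  next
    case z6
    then show ?thesis using scaled[of 6 "- a"] assms(5) by auto
  next
    case z7
    then show ?thesis using scaled[of 7 "- a"] assms(5) by auto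
  qed
qed

text \<open>Any two of the four lines meet in exactly one point, so exchanging their products costs
  an even number of sign changes and the involutions commute. They therefore split every vector into
  joint eigenvectors.\<close>

lemma real_components_UNIV: "real_components = UNIV"
proof -
  have lin: "linear (fano_product p q r)" for p q r
    by (intro linearI) (simp_all add: fano_product_def)
  define lines :: "(nat \<times> nat \<times> nat) set" where "lines = {(1,2,3),(1,4,5),(2,4,6),(3,4,7)}"
  have comm: "fano_product p q r (fano_product p' q' r' x) = fano_product p' q' r' (fano_product p q r x)"
    if "(p, q, r) \<in> lines" "(p', q', r') \<in> lines" for p q r p' q' r' x
    using that by (auto simp: lines_def fano_product_def lm_oe_sort)
  have invol: "fano_product p q r (fano_product p q r x) = x" if "(p, q, r) \<in> lines" for p q r x
    using that by (auto simp: lines_def fano_product_def lm_oe_sort)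
  let ?E = "\<lambda>p q r s. {x. fano_product p q r x = s *\<^sub>R x}"
  have sub: "subspace (?E p q r s)" for p q r and s :: real
    by (simp add: subspace_def linear_add[OF lin] linear_scale[OF lin] linear_0[OF lin] algebra_simps)
  have inv: "fano_product p q r x \<in> ?E p' q' r' s"
    if "(p, q, r) \<in> lines" "(p', q', r') \<in> lines" "x \<in> ?E p' q' r' s" for p q r p' q' r' s x
    using that by (simp add: comm[of p' q' r' p q r] linear_scale[OF lin])
  have lines: "(1,2,3) \<in> lines" "(1,4,5) \<in> lines" "(2,4,6) \<in> lines" "(3,4,7) \<in> lines"
    by (auto simp: lines_def)
  note split = subset_by_involution[OF _ subspace_real_components lin invol]
  \<comment> \<open>The eigenvalue conditions are removed one line at a time.\<close>
  have 3: "?E 1 2 3 a \<inter> ?E 1 4 5 b \<inter> ?E 2 4 6 c \<subseteq> real_components"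
    if "a \<in> {1,-1}" "b \<in> {1,-1}" "c \<in> {1,-1}" for a b c
    by (rule split[OF _ lines(4)], intro subspace_inter sub)
      (use that inv[OF lines(4)] lines fano_eigenvector_in_real_components[of _ a b c] in blast)+
  have 2: "?E 1 2 3 a \<inter> ?E 1 4 5 b \<subseteq> real_components"
    if "a \<in> {1,-1}" "b \<in> {1,-1}" for a b
    by (rule split[OF _ lines(3)], intro subspace_inter sub)
      (use that inv[OF lines(3)] lines 3[of a b] in blast)+
  have 1: "?E 1 2 3 a \<subseteq> real_components" if "a \<in> {1,-1}" for a
    by (rule split[OF _ lines(2)], intro sub)
      (use that inv[OF lines(2)] lines 2[of a] in blast)+
  have "UNIV \<subseteq> real_components"
    by (rule split[OF _ lines(1)], intro subspace_UNIV) (use 1 in blast)+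
  then show ?thesis by blast
qed

(* on the algebra itself the sum over i of e_i x e_i is - 7 Re x + 5 Im x *)
definition real_projection :: "'v \<Rightarrow> 'v" where
  "real_projection x = (1/12) *\<^sub>R (5 *\<^sub>R x - (\<Sum>i\<in>{1..7}. lm (oe i) (rm x (oe i))))"

lemma linear_real_projection: "linear real_projection"
  unfolding real_projection_def
  by (intro linearI) (simp_all add: algebra_simps sum.distrib scaleR_sum_right)

lemma real_projection_lm:
  assumes "n \<in> ReM lm rm"
  shows "real_projection (lm a n) = re a *\<^sub>R n"
proof -
  have sum: "lm (sum f A) x = (\<Sum>i\<in>A. lm (f i) x)" for f x and A :: "nat set"
    by (induction A rule: infinite_finite_induct) auto
  have "real_projection (lm a n) = (1/12) *\<^sub>R lm (5 *\<^sub>R a - (\<Sum>i\<in>{1..7}. oe i \<cdot>\<^sub>O (a \<cdot>\<^sub>O oe i))) n"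
    using assms by (simp add: real_projection_def ReM_rm_lm ReM_lm_lm sum)
  also have "\<dots> = re a *\<^sub>R n"
    unfolding oct_real_part by (simp add: oone_eq)
  finally show ?thesis .
qed

section \<open>Real parts in the bimodule, and the operators in \<open>B_RO\<close>\<close>

lemma re_oe: "re (oe i) = (if i = 0 then 1 else 0)"
  by (simp add: oe_def)

lemma real_components_obtain:
  obtains xs where "\<And>i. i < 8 \<Longrightarrow> xs i \<in> ReM lm rm" "x = (\<Sum>i<8. lm (oe i) (xs i))"
proof -
  have "x \<in> real_components" by (simp add: real_components_UNIV)
  then show thesis unfolding real_components_def using that by blast
qed

text \<open>The linear formula reads off the zeroth component of every decomposition, which gives
  the uniqueness that the description in \<open>ReV\<close> requires.\<close>

lemma ReV_eq_real_projection: "ReV lm rm x = real_projection x"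
proof -
  have proj: "real_projection (\<Sum>i<8. lm (oe i) (xs i)) = xs 0"
    if "\<forall>i<8. xs i \<in> ReM lm rm" for xs
  proof -
    have "real_projection (\<Sum>i<8. lm (oe i) (xs i)) = (\<Sum>i<8. real_projection (lm (oe i) (xs i)))"
      by (rule linear_sum[OF linear_real_projection])
    also have "\<dots> = (\<Sum>i<8. if i = 0 then xs i else 0)"
      using that by (intro sum.cong) (auto simp: real_projection_lm re_oe)
    finally show ?thesis by simp
  qed
  obtain xs where xs: "\<forall>i<8. xs i \<in> ReM lm rm" "x = (\<Sum>i<8. lm (oe i) (xs i))"
    using real_components_obtain[of x] by metis
  show ?thesis
    unfolding ReV_def
  proof (rule the_equality)
    show "\<exists>ys. (\<forall>i<8. ys i \<in> ReM lm rm) \<and> ys 0 = real_projection x \<and> x = (\<Sum>i<8. lm (oe i) (ys i))"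
      using xs proj[of xs] by (intro exI[of _ xs]) simp
  qed (metis proj)
qed

lemma real_projection_assoc_r:
  "real_projection (rm (rm y p) q) = real_projection (rm y (p \<cdot>\<^sub>O q))"
proof -
  obtain xs where xs: "\<And>i. i < 8 \<Longrightarrow> xs i \<in> ReM lm rm" and y: "y = (\<Sum>i<8. lm (oe i) (xs i))"
    using real_components_obtain[of y] by blast
  have sum: "rm (sum f A) p = (\<Sum>i\<in>A. rm (f i) p)" for f p and A :: "nat set"
    by (induction A rule: infinite_finite_induct) auto
  show ?thesis
    unfolding y sum linear_sum[OF linear_real_projection]
    by (intro sum.cong) (simp_all add: xs ReM_rm_lm real_projection_lm re_omult_assoc)
qed

text \<open>Right multiplication by e_j moves the j-th component, up to sign, into the zeroth
  place.\<close>

lemma eq_0_if_real_projections_0: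
  assumes "\<And>q. real_projection (rm y q) = 0"
  shows "y = 0"
proof -
  obtain xs where xs: "\<And>i. i < 8 \<Longrightarrow> xs i \<in> ReM lm rm" and y: "y = (\<Sum>i<8. lm (oe i) (xs i))"
    using real_components_obtain[of y] by blast
  have sum: "rm (sum f A) p = (\<Sum>i\<in>A. rm (f i) p)" for f p and A :: "nat set"
    by (induction A rule: infinite_finite_induct) auto
  have "xs j = 0" if j: "j < 8" for j
  proof -
    have "0 = real_projection (rm y (oe j))" using assms by simp
    also have "\<dots> = (\<Sum>i<8. re (oe i \<cdot>\<^sub>O oe j) *\<^sub>R xs i)"
      unfolding y sum linear_sum[OF linear_real_projection]
      by (intro sum.cong) (simp_all add: xs ReM_rm_lm real_projection_lm)
    also have "\<dots> = (\<Sum>i<8. if i = j then (if j = 0 then 1 else -1) *\<^sub>R xs i else 0)"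
      using j by (intro sum.cong) (auto simp: less_8_cases oe_mult re_oe)
    finally show ?thesis using j by (auto split: if_splits)
  qed
  then show ?thesis by (simp add: y)
qed

lemma ReM_nontrivial:
  assumes "\<exists>v::'v. v \<noteq> 0"
  shows "\<exists>v\<in>ReM lm rm. v \<noteq> 0"
proof (rule ccontr)
  assume *: "\<not> ?thesis"
  have "v = 0" for v :: 'v
  proof -
    obtain xs where "\<And>i. i < 8 \<Longrightarrow> xs i \<in> ReM lm rm" and v: "v = (\<Sum>i<8. lm (oe i) (xs i))"
      using real_components_obtain[of v] by metis
    then have "xs i = 0" if "i < 8" for i
      using * that by blast
    then show ?thesis by (simp add: v)
  qed
  with assms show False by blast
qed

text \<open>For real v, (vp)q = v(pq), hence Re(f(vp) q) = Re(f(v)(pq)) = Re((f(v)p) q), as real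
  parts ignore bracketing. Since q is arbitrary, f(vp) = f(v)p.\<close>

lemma para_linear_on_ReM:
  assumes f: "linear f" and para: "\<And>p x. ReV lm rm (rm (f x) p - f (rm x p)) = 0"
    and v: "v \<in> ReM lm rm"
  shows "f (rm v p) = rm (f v) p"
proof -
  have para': "real_projection (f (rm x p)) = real_projection (rm (f x) p)" for x p
    using para[of x p] by (simp add: ReV_eq_real_projection linear_diff[OF linear_real_projection])
  have "f (rm v p) - rm (f v) p = 0"
  proof (rule eq_0_if_real_projections_0)
    fix q
    have "real_projection (rm (f (rm v p)) q) = real_projection (f (rm (rm v p) q))"
      by (simp add: para')
    also have "rm (rm v p) q = rm v (p \<cdot>\<^sub>O q)"
      using v by (simp add: ReM_commute ReM_rm_lm)
    also have "real_projection (f (rm v (p \<cdot>\<^sub>O q))) = real_projection (rm (rm (f v) p) q)"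
      by (simp add: para' real_projection_assoc_r)
    finally show "real_projection (rm (f (rm v p) - rm (f v) p) q) = 0"
      by (simp add: linear_diff[OF linear_real_projection])
  qed
  then show ?thesis by simp
qed

end

section \<open>Spectra of real operators on a complex Banach space\<close>

text \<open>The inverse sends x to the fixed point of the contraction y -> x + A y. Running the
  contraction inside a closed A-invariant subspace W shows that the inverse preserves W.\<close>

lemma neumann_inverse:
  fixes A :: "'v::banach \<Rightarrow> 'v"
  assumes A: "bounded_linear A" and small: "onorm A < 1"
  obtains h where "bounded_linear h" "\<And>x. h (x - A x) = x" "\<And>x. h x - A (h x) = x"
    "\<And>W x. closed W \<Longrightarrow> subspace W \<Longrightarrow> (\<And>y. y \<in> W \<Longrightarrow> A y \<in> W) \<Longrightarrow> x \<in> W \<Longrightarrow> h x \<in> W"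
proof -
  interpret A: bounded_linear A by fact
  have fix_in: "\<exists>!y\<in>W. x + A y = y"
    if "closed W" "subspace W" "\<And>y. y \<in> W \<Longrightarrow> A y \<in> W" "x \<in> W" for W x
  proof (rule Banach_fix)
    show "complete W" using that(1) by (simp add: complete_eq_closed)
    show "W \<noteq> {}" using that(4) by blast
    show "(\<lambda>y. x + A y) ` W \<subseteq> W" using that by (auto intro: subspace_add)
    show "dist (x + A y) (x + A z) \<le> onorm A * dist y z" for y z
      using onorm[OF A, of "y - z"] by (simp add: dist_norm A.diff)
  qed (use small onorm_pos_le[OF A] in auto)
  then have ex1: "\<exists>!y. x + A y = y" for x
    using fix_in[of UNIV x] by auto
  define h where "h x = (THE y. x + A y = y)" for x
  have h: "x + A (h x) = h x" for x
    unfolding h_def by (rule theI'[OF ex1])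
  have uniq: "h x = y" if "x + A y = y" for x y
    using ex1 h that by blast
  have "bounded_linear h"
  proof (rule bounded_linear_intro)
    show "h (x + y) = h x + h y" for x y
    proof (rule uniq)
      have "x + y + A (h x + h y) = (x + A (h x)) + (y + A (h y))" by (simp add: A.add add_ac)
      then show "x + y + A (h x + h y) = h x + h y" by (simp only: h)
    qed
    show "h (r *\<^sub>R x) = r *\<^sub>R h x" for r x
      by (rule uniq) (metis A.scaleR h scaleR_add_right)
    show "norm (h x) \<le> norm x * (1 / (1 - onorm A))" for x
    proof -
      have "norm (h x) \<le> norm x + norm (A (h x))"
        using norm_triangle_ineq[of x "A (h x)"] h[of x] by simp
      also have "norm (A (h x)) \<le> onorm A * norm (h x)" by (rule onorm[OF A])
      finally show ?thesis using small by (simp add: field_simps)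
    qed
  qed
  moreover have "h (x - A x) = x" for x by (rule uniq) simp
  moreover have "h x - A (h x) = x" for x using h[of x] by (simp add: diff_eq_eq)
  moreover have "h x \<in> W" if "closed W" "subspace W" "\<And>y. y \<in> W \<Longrightarrow> A y \<in> W" "x \<in> W" for W x
    using fix_in[OF that] uniq by auto
  ultimately show ?thesis using that by blast
qed

lemma bounded_linear_funpow:
  fixes T :: "'a::real_normed_vector \<Rightarrow> 'a"
  assumes "bounded_linear T"
  shows "bounded_linear (T ^^ n)"
proof (induction n)
  case 0 then show ?case by (simp add: id_def bounded_linear_ident)
next
  case (Suc n)
  then show ?case using bounded_linear_compose[OF assms Suc] by (simp add: o_def)
qed

text \<open>The type carries only a real structure and the complex one will depend on J, so
  multiplication by i is given as an operator K.\<close>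

locale complex_structure =
  fixes K :: "'v::banach \<Rightarrow> 'v"
  assumes linear_K: "linear K" and K_K: "K (K x) = - x"
    and norm_cs': "norm (Re z *\<^sub>R x + Im z *\<^sub>R K x) = cmod z * norm x"
begin

definition cs :: "complex \<Rightarrow> 'v \<Rightarrow> 'v" where
  "cs z x = Re z *\<^sub>R x + Im z *\<^sub>R K x"

lemma norm_cs: "norm (cs z x) = cmod z * norm x"
  by (simp add: cs_def norm_cs')

lemmas K_simps = linear_add[OF linear_K] linear_diff[OF linear_K] linear_scale[OF linear_K]
  linear_neg[OF linear_K] linear_0[OF linear_K]

lemma bounded_bilinear_cs: "bounded_bilinear cs"
  by (rule bounded_bilinear.intro)
    (auto simp: cs_def K_simps algebra_simps norm_cs[unfolded cs_def] intro!: exI[of _ 1])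

sublocale cs: bounded_bilinear cs
  by (rule bounded_bilinear_cs)

lemma cs_mult: "cs (z * w) x = cs z (cs w x)"
  by (simp add: cs_def K_simps K_K algebra_simps)

lemma cs_1 [simp]: "cs 1 x = x" and cs_i: "cs \<i> x = K x"
  by (simp_all add: cs_def)

lemma cs_K: "cs z (K x) = K (cs z x)"
  by (simp add: cs_def K_simps)

lemma bounded_linear_K: "bounded_linear K"
  using cs.bounded_linear_right[of \<i>] by (simp add: cs_i)

lemma cs_commute:
  assumes "linear T" "T (K x) = K (T x)"
  shows "T (cs z x) = cs z (T x)"
  by (simp add: cs_def linear_add[OF assms(1)] linear_scale[OF assms(1)] assms(2))

text \<open>Commutation is asked of all powers at once, which makes the set T-invariant; for T alone
  this could fail.\<close>

definition K_power_commutant :: "('v \<Rightarrow> 'v) \<Rightarrow> 'v set" where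
  "K_power_commutant T = {x. \<forall>n. (T ^^ n) (K x) = K ((T ^^ n) x)}"

text \<open>N will be the real part of the bimodule; the last condition then says that g is
  extendable.\<close>

definition resolvent_on :: "'v set \<Rightarrow> ('v \<Rightarrow> 'v) \<Rightarrow> complex \<Rightarrow> ('v \<Rightarrow> 'v) \<Rightarrow> bool" where
  "resolvent_on N T z g \<longleftrightarrow> bounded_linear g \<and> (\<forall>x. g (cs z x - T x) = x)
     \<and> (\<forall>x. cs z (g x) - T (g x) = x) \<and> N \<subseteq> K_power_commutant g"

section \<open>The power commutant as a closed, T-invariant complex subspace\<close>

context
  fixes T :: "'v \<Rightarrow> 'v" assumes T: "bounded_linear T"
begin

lemma linear_funpow: "linear (T ^^ n)"
  by (rule bounded_linear.linear[OF bounded_linear_funpow[OF T]])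

lemma subspace_K_power_commutant: "subspace (K_power_commutant T)"
  unfolding K_power_commutant_def subspace_def
  by (simp add: K_simps linear_add[OF linear_funpow] linear_scale[OF linear_funpow] linear_0[OF linear_funpow])

lemma closed_K_power_commutant: "closed (K_power_commutant T)"
proof -
  have "K_power_commutant T = (\<Inter>n. {x. (T ^^ n) (K x) = K ((T ^^ n) x)})"
    by (auto simp: K_power_commutant_def)
  also have "closed \<dots>"
    by (intro closed_INT ballI closed_Collect_eq)
      (auto intro!: bounded_linear.continuous_on[OF bounded_linear_funpow[OF T]]
         bounded_linear.continuous_on[OF bounded_linear_K] continuous_on_id)
  finally show ?thesis .
qed

lemma K_power_commutant_apply:
  assumes "x \<in> K_power_commutant T"
  shows "T x \<in> K_power_commutant T" "T (K x) = K (T x)"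
proof -
  have "(T ^^ n) (K x) = K ((T ^^ n) x)" for n
    using assms by (auto simp: K_power_commutant_def)
  \<comment> \<open>Exponent 1 gives commutation at x, the exponents \<open>Suc n\<close> give it at
    \<open>T x\<close>.\<close>
  note * = this[of 1] this[of "Suc n" for n]
  then show "T (K x) = K (T x)" by (simp add: One_nat_def)
  with * show "T x \<in> K_power_commutant T"
    by (simp add: K_power_commutant_def funpow_swap1)
qed

lemma K_power_commutant_K:
  assumes "x \<in> K_power_commutant T" shows "K x \<in> K_power_commutant T"
  using assms by (simp add: K_power_commutant_def K_K linear_neg[OF linear_funpow])

lemma K_power_commutant_cs:
  assumes "x \<in> K_power_commutant T" shows "cs z x \<in> K_power_commutant T"
  unfolding cs_def
  by (intro subspace_add[OF subspace_K_power_commutant] subspace_scale[OF subspace_K_power_commutant]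
      assms K_power_commutant_K)

end

lemma subset_K_power_commutant:
  assumes "\<And>x. x \<in> W \<Longrightarrow> g x \<in> W" "\<And>x. x \<in> W \<Longrightarrow> g (K x) = K (g x)"
  shows "W \<subseteq> K_power_commutant g"
proof
  fix x assume x: "x \<in> W"
  have "(g ^^ n) x \<in> W \<and> (g ^^ n) (K x) = K ((g ^^ n) x)" for n
    by (induction n) (use x assms in auto)
  then show "x \<in> K_power_commutant g" by (simp add: K_power_commutant_def)
qed

text \<open>As h x stays in W, where A commutes with K, the vector K (h x) solves the equation whose
  solution is h (K x).\<close>

lemma neumann_commutes:
  assumes "bounded_linear A" "onorm A < 1"
    and W: "closed W" "subspace W" "\<And>x. x \<in> W \<Longrightarrow> K x \<in> W"
    and A: "\<And>x. x \<in> W \<Longrightarrow> A x \<in> W" "\<And>x. x \<in> W \<Longrightarrow> A (K x) = K (A x)"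
  obtains h where "bounded_linear h" "\<And>x. h (x - A x) = x" "\<And>x. h x - A (h x) = x"
    "\<And>x. x \<in> W \<Longrightarrow> h x \<in> W" "\<And>x. x \<in> W \<Longrightarrow> h (K x) = K (h x)"
proof -
  obtain h where h: "bounded_linear h" "\<And>x. h (x - A x) = x" "\<And>x. h x - A (h x) = x"
    "\<And>W x. closed W \<Longrightarrow> subspace W \<Longrightarrow> (\<And>y. y \<in> W \<Longrightarrow> A y \<in> W) \<Longrightarrow> x \<in> W \<Longrightarrow> h x \<in> W"
    using neumann_inverse[OF assms(1,2)] by metis
  have hW: "h x \<in> W" if "x \<in> W" for x using h(4) W A(1) that by blast
  have "h (K x) = K (h x)" if "x \<in> W" for x
  proof -
    have "K (h x) - A (K (h x)) = K x"
      using A(2)[OF hW[OF that]] h(3)[of x] by (simp flip: linear_diff[OF linear_K])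
    then show ?thesis using h(2)[of "K (h x)"] by simp
  qed
  then show ?thesis using that h(1-3) hW by blast
qed

section \<open>Resolvents from Neumann series\<close>

lemma resolvent_outside_norm_ball:
  assumes T: "bounded_linear T" and N: "N \<subseteq> K_power_commutant T" and z: "onorm T < cmod z"
  shows "\<exists>g. resolvent_on N T z g"
proof -
  let ?W = "K_power_commutant T"
  have z0: "z \<noteq> 0" using z onorm_pos_le[OF T] by auto
  define A where "A x = cs (1 / z) (T x)" for x
  have A: "bounded_linear A"
    unfolding A_def by (intro bounded_linear_compose[OF cs.bounded_linear_right T])
  have "onorm A \<le> onorm T / cmod z"
    by (rule onorm_bound) (use onorm[OF T] onorm_pos_le[OF T] z0 in \<open>auto simp: A_def norm_cs norm_divide field_simps\<close>)
  also have "\<dots> < 1" using z z0 by simp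
  finally have small: "onorm A < 1" .
  obtain h where h: "bounded_linear h" "\<And>x. h (x - A x) = x" "\<And>x. h x - A (h x) = x"
    "\<And>x. x \<in> ?W \<Longrightarrow> h x \<in> ?W" "\<And>x. x \<in> ?W \<Longrightarrow> h (K x) = K (h x)"
    by (rule neumann_commutes[OF A small closed_K_power_commutant[OF T] subspace_K_power_commutant[OF T]])
      (auto simp: A_def K_power_commutant_apply[OF T] K_power_commutant_cs[OF T] K_power_commutant_K[OF T] cs_K)
  \<comment> \<open>T need not be complex linear, so the scalar stays on the left: z - T = z (1 -
    A). The inverse first divides by z and then applies h.\<close>
  have factor: "cs z x - T x = cs z (x - A x)" for x
    using z0 by (simp add: A_def cs.diff_right flip: cs_mult)
  have cs_cancel: "cs (1 / z) (cs z x) = x" "cs z (cs (1 / z) x) = x" for x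
    using z0 by (simp_all flip: cs_mult)
  define g where "g x = h (cs (1 / z) x)" for x
  have "resolvent_on N T z g"
    unfolding resolvent_on_def
  proof (intro conjI allI)
    show "bounded_linear g"
      unfolding g_def by (intro bounded_linear_compose[OF h(1) cs.bounded_linear_right])
    show "g (cs z x - T x) = x" for x by (simp add: g_def factor cs_cancel h(2))
    show "cs z (g x) - T (g x) = x" for x by (simp only: factor) (simp add: g_def cs_cancel h(3))
    have "?W \<subseteq> K_power_commutant g"
      by (rule subset_K_power_commutant)
        (simp_all add: g_def K_power_commutant_cs[OF T] h(4,5) cs_K)
    with N show "N \<subseteq> K_power_commutant g" by blast
  qed
  then show ?thesis by blast
qed

text \<open>With A = (s - z) g one has z - T = (1 - A)(s - T), so the new resolvent is g h. The
  invariant subspace is now the commutant of g, which contains N.\<close>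

lemma resolvent_near:
  assumes g: "resolvent_on N T s g" and z: "cmod (s - z) * onorm g < 1"
  shows "\<exists>g'. resolvent_on N T z g'"
proof -
  have bg: "bounded_linear g" and inv: "\<And>x. g (cs s x - T x) = x" "\<And>x. cs s (g x) - T (g x) = x"
    and N: "N \<subseteq> K_power_commutant g"
    using g by (auto simp: resolvent_on_def)
  let ?W = "K_power_commutant g"
  define A where "A x = cs (s - z) (g x)" for x
  have A: "bounded_linear A"
    unfolding A_def by (intro bounded_linear_compose[OF cs.bounded_linear_right bg])
  have "onorm A \<le> cmod (s - z) * onorm g"
    by (rule onorm_bound) (use onorm[OF bg] onorm_pos_le[OF bg] in \<open>auto simp: A_def norm_cs mult.assoc intro!: mult_left_mono\<close>)
  then have small: "onorm A < 1" using z by simp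
  obtain h where h: "bounded_linear h" "\<And>x. h (x - A x) = x" "\<And>x. h x - A (h x) = x"
    "\<And>x. x \<in> ?W \<Longrightarrow> h x \<in> ?W" "\<And>x. x \<in> ?W \<Longrightarrow> h (K x) = K (h x)"
    by (rule neumann_commutes[OF A small closed_K_power_commutant[OF bg] subspace_K_power_commutant[OF bg]])
      (auto simp: A_def K_power_commutant_apply[OF bg] K_power_commutant_cs[OF bg] K_power_commutant_K[OF bg] cs_K)
  have factor: "cs z x - T x = (cs s x - T x) - A (cs s x - T x)" for x
    by (simp add: A_def inv cs.diff_left)
  define g' where "g' x = g (h x)" for x
  have "resolvent_on N T z g'"
    unfolding resolvent_on_def
  proof (intro conjI allI)
    show "bounded_linear g'"
      unfolding g'_def by (intro bounded_linear_compose[OF bg h(1)])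
    show "g' (cs z x - T x) = x" for x by (simp add: g'_def factor inv h(2))
    show "cs z (g' x) - T (g' x) = x" for x by (simp add: g'_def factor inv h(3))
    have "?W \<subseteq> K_power_commutant g'"
      by (rule subset_K_power_commutant) (simp_all add: g'_def h(4,5) K_power_commutant_apply[OF bg])
    with N show "N \<subseteq> K_power_commutant g'" by blast
  qed
  then show ?thesis by blast
qed

lemma open_resolvent_set: "open {z. \<exists>g. resolvent_on N T z g}"
  unfolding open_dist
proof (clarsimp)
  fix s g assume g: "resolvent_on N T s g"
  have pos: "onorm g \<ge> 0" using g by (auto simp: resolvent_on_def intro: onorm_pos_le)
  show "\<exists>e>0. \<forall>z. dist z s < e \<longrightarrow> (\<exists>g. resolvent_on N T z g)"
  \<comment> \<open>The summand 1 keeps the denominator positive even if \<open>onorm g\<close> is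
    0.\<close>
  proof (intro exI[of _ "1 / (onorm g + 1)"] conjI allI impI)
    show "1 / (onorm g + 1) > 0" using pos by simp
    fix z assume z: "dist z s < 1 / (onorm g + 1)"
    then have "cmod (s - z) * (onorm g + 1) < 1"
      using pos by (simp add: dist_norm norm_minus_commute field_simps)
    moreover have "cmod (s - z) * onorm g \<le> cmod (s - z) * (onorm g + 1)"
      by (intro mult_left_mono) auto
    ultimately show "\<exists>g. resolvent_on N T z g" by (intro resolvent_near[OF g]) simp
  qed
qed

(* Liouville without the Hahn-Banach theorem: P t, the integral of G over the circle of radius exp t
   with respect to the angle, is constant in t, as the t-derivative of G (exp (t + i \<theta>)) is - K applied
   to its \<theta>-derivative; letting t tend to both ends gives P = 0 and P = 2 pi G 0 *)
lemma entire_vanishing_at_infinity: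
  assumes der: "\<And>z. (G has_derivative (\<lambda>h. cs h (H z))) (at z)"
    and cont: "continuous_on UNIV H" and lim: "(G \<longlongrightarrow> 0) at_infinity"
  shows "G 0 = 0"
proof -
  define w :: "real \<Rightarrow> real \<Rightarrow> complex" where "w t \<theta> = exp (of_real t + \<i> * of_real \<theta>)" for t \<theta>
  define M where "M t \<theta> = cs (w t \<theta>) (H (w t \<theta>))" for t \<theta>
  have norm_w: "cmod (w t \<theta>) = exp t" for t \<theta>
    by (simp add: w_def norm_exp_eq_Re)
  have dt: "((\<lambda>t. G (w t \<theta>)) has_vector_derivative M t \<theta>) (at t within S)" for t \<theta> S
  proof -
    have "((\<lambda>t. w t \<theta>) has_vector_derivative w t \<theta>) (at t within S)"
      unfolding w_def
      by (rule has_vector_derivative_real_field) (auto intro!: derivative_eq_intros)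
    from has_derivative_compose[OF this[unfolded has_vector_derivative_def] der]
    show ?thesis
      by (simp add: has_vector_derivative_def M_def cs.scaleR_left)
  qed
  have d\<theta>: "((\<lambda>\<theta>. G (w t \<theta>)) has_vector_derivative K (M t \<theta>)) (at \<theta> within S)" for t \<theta> S
  proof -
    have "((\<lambda>\<theta>. w t \<theta>) has_vector_derivative \<i> * w t \<theta>) (at \<theta> within S)"
      unfolding w_def
      by (rule has_vector_derivative_real_field) (auto intro!: derivative_eq_intros)
    from has_derivative_compose[OF this[unfolded has_vector_derivative_def] der]
    show ?thesis
      by (simp add: has_vector_derivative_def M_def cs.scaleR_left cs_mult cs_i)
  qed
  have contG: "continuous_on UNIV G"
    by (meson der continuous_at_imp_continuous_on has_derivative_continuous)
  have contGw: "continuous_on S (\<lambda>\<theta>. G (w t \<theta>))" for t S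
    unfolding w_def by (intro continuous_on_compose2[OF contG] continuous_intros) auto
  have contM: "continuous_on S (\<lambda>(t, \<theta>). M t \<theta>)" for S
    unfolding M_def w_def split_beta
    by (intro cs.continuous_on continuous_on_compose2[OF cont] continuous_intros) auto
  define P where "P t = integral {0..2 * pi} (\<lambda>\<theta>. G (w t \<theta>))" for t
  \<comment> \<open>K (M t \<theta>) is the \<theta>-derivative of a periodic function, so it
    integrates to 0; applying K again gives the same for -M.\<close>
  have intM: "integral {0..2 * pi} (M t) = 0" for t
  proof -
    have "((\<lambda>\<theta>. K (M t \<theta>)) has_integral (G (w t (2 * pi)) - G (w t 0))) {0..2 * pi}"
      by (rule fundamental_theorem_of_calculus[OF _ d\<theta>]) simp
    moreover have "w t (2 * pi) = w t 0"
      by (simp add: w_def exp_add) (simp add: exp_two_pi_i mult.commute)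
    ultimately have "((\<lambda>\<theta>. K (M t \<theta>)) has_integral 0) {0..2 * pi}" by simp
    from has_integral_linear[OF this bounded_linear_K]
    have "((\<lambda>\<theta>. - M t \<theta>) has_integral 0) {0..2 * pi}" by (simp add: o_def K_K K_simps)
    from has_integral_neg[OF this] show ?thesis by (simp add: integral_unique)
  qed
  have "(P has_vector_derivative 0) (at t within UNIV)" for t
  proof -
    have "((\<lambda>t. integral (cbox 0 (2 * pi)) (\<lambda>\<theta>. G (w t \<theta>))) has_vector_derivative integral (cbox 0 (2 * pi)) (M t)) (at t within UNIV)"
      by (rule leibniz_rule_vector_derivative)
        (auto intro!: dt integrable_continuous_real contGw contM)
    then show ?thesis by (simp add: P_def[abs_def] intM)
  qed
  then obtain c where c: "\<And>t. P t = c"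
    using has_vector_derivative_zero_constant[of UNIV P] by auto
  \<comment> \<open>All circle integrals equal c, so closeness of G to a on one circle controls c.
    This is used with a = 0 on a large circle and a = G 0 on a small one.\<close>
  have bound: "norm (c - (2 * pi) *\<^sub>R a) \<le> e * (2 * pi)"
    if "\<And>\<theta>. norm (G (w t \<theta>) - a) \<le> e" for t a e
  proof -
    have "(\<lambda>\<theta>. G (w t \<theta>)) integrable_on {0..2 * pi}"
      by (intro integrable_continuous_real contGw)
    then have "integral {0..2 * pi} (\<lambda>\<theta>. G (w t \<theta>) - a) = c - (2 * pi) *\<^sub>R a"
      using c[of t] by (subst integral_diff) (auto simp: P_def)
    moreover have "norm (integral {0..2 * pi} (\<lambda>\<theta>. G (w t \<theta>) - a)) \<le> e * (2 * pi - 0)"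
      by (rule integral_bound) (auto intro!: continuous_intros contGw that)
    ultimately show ?thesis by simp
  qed
  have small: "x = 0" if "\<And>e. e > 0 \<Longrightarrow> norm x \<le> e * (2 * pi)" for x :: 'v
  proof (rule ccontr)
    assume "x \<noteq> 0"
    then show False using that[of "norm x / (4 * pi)"] by (simp add: field_simps)
  qed
  have "c = 0"
  proof (rule small)
    fix e :: real assume e: "e > 0"
    then obtain B where B: "\<And>z. cmod z \<ge> B \<Longrightarrow> norm (G z) < e"
      using lim unfolding tendsto_iff eventually_at_infinity dist_norm by auto
    \<comment> \<open>The maximum with 1 makes the radius positive, so that \<open>exp\<close>
      undoes \<open>ln\<close>.\<close>
    have "norm (G (w (ln (max B 1)) \<theta>) - 0) \<le> e" for \<theta>
      using B[of "w (ln (max B 1)) \<theta>"] by (simp add: norm_w)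
    from bound[OF this] show "norm c \<le> e * (2 * pi)" by simp
  qed
  moreover have "c - (2 * pi) *\<^sub>R G 0 = 0"
  proof (rule small)
    fix e :: real assume e: "e > 0"
    obtain d where d: "d > 0" "\<And>z. cmod z < d \<Longrightarrow> norm (G z - G 0) < e"
      using contG e unfolding continuous_on_iff dist_norm by (metis UNIV_I diff_zero)
    have "norm (G (w (ln (d / 2)) \<theta>) - G 0) \<le> e" for \<theta>
      using d(2)[of "w (ln (d / 2)) \<theta>"] d(1) by (simp add: norm_w)
    from bound[OF this] show "norm (c - (2 * pi) *\<^sub>R G 0) \<le> e * (2 * pi)" .
  qed
  ultimately show ?thesis by simp
qed

text \<open>Each g z is only known to be real linear. Still z -> g z v is complex differentiable,
  because v in N lies in the power commutant of g s, where scalars can be pulled out of g s.\<close>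

lemma resolvent_set_not_UNIV:
  assumes T: "bounded_linear T" and v: "v \<in> N" "v \<noteq> 0"
  shows "\<exists>z. \<nexists>g. resolvent_on N T z g"
proof (rule ccontr)
  assume "\<not> ?thesis"
  then obtain g where g: "\<And>z. resolvent_on N T z (g z)" by metis
  have bg: "bounded_linear (g z)" and inv: "g z (cs z x - T x) = x" "cs z (g z x) - T (g z x) = x"
    and com: "v \<in> K_power_commutant (g z)" for z x
    using g[of z] v(1) by (auto simp: resolvent_on_def)
  define G where "G z = g z v" for z
  define H where "H z = - g z (g z v)" for z
  \<comment> \<open>The resolvent identity with the scalar kept inside g s, so that real linearity
    is enough.\<close>
  have resolvent_eq: "g z x - g s x = g s (cs (s - z) (g z x))" for z s x
  proof -
    have "cs s (g z x) - T (g z x) = x + cs (s - z) (g z x)"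
      using inv(2)[of z x] by (simp add: cs.diff_left algebra_simps)
    then have "g z x = g s (x + cs (s - z) (g z x))" using inv(1)[of s "g z x"] by simp
    then show ?thesis
      by (metis linear_add[OF bounded_linear.linear[OF bg]] inv(1) add_diff_cancel_left' inv(2))
  qed
  \<comment> \<open>With the factor 1/2 the term in \<open>g z x\<close> on the right can be
    absorbed on the left.\<close>
  have near: "norm (g z x) \<le> 2 * onorm (g s) * norm x"
    "norm (g z x - g s x) \<le> 2 * (onorm (g s))\<^sup>2 * cmod (z - s) * norm x"
    if "onorm (g s) * cmod (z - s) \<le> 1 / 2" for z s x
  proof -
    have 1: "norm (g z x - g s x) \<le> onorm (g s) * (cmod (z - s) * norm (g z x))"
      unfolding resolvent_eq using onorm[OF bg, of s "cs (s - z) (g z x)"]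
      by (simp add: norm_cs norm_minus_commute)
    have "onorm (g s) * cmod (z - s) * norm (g z x) \<le> 1 / 2 * norm (g z x)"
      using that by (intro mult_right_mono) auto
    moreover have "norm (g z x) \<le> norm (g z x - g s x) + norm (g s x)"
      using norm_triangle_ineq[of "g z x - g s x" "g s x"] by simp
    ultimately show 2: "norm (g z x) \<le> 2 * onorm (g s) * norm x"
      using 1 onorm[OF bg, of s x] by (simp add: mult.assoc)
    have "onorm (g s) * (cmod (z - s) * norm (g z x)) \<le> onorm (g s) * (cmod (z - s) * (2 * onorm (g s) * norm x))"
      using 2 by (intro mult_left_mono onorm_pos_le[OF bg]) auto
    with 1 show "norm (g z x - g s x) \<le> 2 * (onorm (g s))\<^sup>2 * cmod (z - s) * norm x"
      by (simp add: power2_eq_square algebra_simps)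
  qed
  have nearby: "\<forall>\<^sub>F z in at s. onorm (g s) * cmod (z - s) \<le> 1 / 2" for s
  proof -
    have "((\<lambda>z. onorm (g s) * cmod (z - s)) \<longlongrightarrow> onorm (g s) * cmod (s - s)) (at s)"
      by (intro tendsto_intros)
    then have "\<forall>\<^sub>F z in at s. onorm (g s) * cmod (z - s) < 1 / 2"
      by (rule order_tendstoD) simp
    then show ?thesis by eventually_elim simp
  qed
  have der: "(G has_derivative (\<lambda>h. cs h (H s))) (at s)" for s
  proof -
    let ?C = "2 * onorm (g s) ^ 3 * norm v"
    have est: "norm ((G z - G s - cs (z - s) (H s)) /\<^sub>R norm (z - s)) \<le> ?C * cmod (z - s)"
      if small: "onorm (g s) * cmod (z - s) \<le> 1 / 2" and "z \<noteq> s" for z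
    proof -
      have "cs (z - s) (H s) = cs (s - z) (g s (g s v))"
        by (simp add: H_def cs.diff_left cs.minus_right)
      \<comment> \<open>Here the commutant enters: with v it also contains g s v.\<close>
      also have "\<dots> = g s (cs (s - z) (g s v))"
        using cs_commute[OF bounded_linear.linear[OF bg]] K_power_commutant_apply[OF bg] com by metis
      finally have "G z - G s - cs (z - s) (H s) = g s (cs (s - z) (g z v - g s v))"
        by (simp only: G_def resolvent_eq[of z v s, symmetric] cs.diff_right linear_diff[OF bounded_linear.linear[OF bg]])
      also have "norm \<dots> \<le> onorm (g s) * (cmod (z - s) * norm (g z v - g s v))"
        using onorm[OF bg, of s "cs (s - z) (g z v - g s v)"] by (simp add: norm_cs norm_minus_commute)
      also have "\<dots> \<le> onorm (g s) * (cmod (z - s) * (2 * (onorm (g s))\<^sup>2 * cmod (z - s) * norm v))"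
        using near(2)[OF small] by (intro mult_left_mono onorm_pos_le[OF bg]) auto
      finally have "norm (G z - G s - cs (z - s) (H s)) \<le> ?C * cmod (z - s) * cmod (z - s)"
        by (simp add: power2_eq_square power3_eq_cube algebra_simps)
      then show ?thesis using \<open>z \<noteq> s\<close> by (simp add: divide_simps)
    qed
    have "((\<lambda>z. ?C * cmod (z - s)) \<longlongrightarrow> ?C * cmod (s - s)) (at s)"
      by (intro tendsto_intros)
    then have C0: "((\<lambda>z. ?C * cmod (z - s)) \<longlongrightarrow> 0) (at s)" by simp
    have "((\<lambda>z. (G z - G s - cs (z - s) (H s)) /\<^sub>R norm (z - s)) \<longlongrightarrow> 0) (at s)"
      by (rule Lim_null_comparison[OF _ C0])
        (use nearby[of s] eventually_at_filter[of "\<lambda>z. z \<noteq> s" s UNIV] est in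
          \<open>auto elim!: eventually_mono simp: eventually_at_filter\<close>)
    then show ?thesis
      unfolding has_derivative_at_within
      by (simp add: cs.bounded_linear_left)
  qed
  have "isCont H s" for s
  proof -
    \<comment> \<open>The two terms of the splitting contribute 4 and 2, rounded up to 8.\<close>
    let ?C = "8 * onorm (g s) ^ 3 * norm v"
    have est: "norm (H z - H s) \<le> ?C * cmod (z - s)"
      if small: "onorm (g s) * cmod (z - s) \<le> 1 / 2" for z
    proof -
      have "norm (H z - H s) = norm (g z (g z v - g s v) + (g z (g s v) - g s (g s v)))"
        by (simp add: H_def linear_diff[OF bounded_linear.linear[OF bg]] norm_minus_commute)
      also have "\<dots> \<le> norm (g z (g z v - g s v)) + norm (g z (g s v) - g s (g s v))"
        by (rule norm_triangle_ineq)
      also have "norm (g z (g z v - g s v)) \<le> 2 * onorm (g s) * (2 * (onorm (g s))\<^sup>2 * cmod (z - s) * norm v)"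
        using near(1)[OF small, of "g z v - g s v"] near(2)[OF small, of v]
        by (meson mult_left_mono mult_nonneg_nonneg onorm_pos_le[OF bg] order_trans zero_le_numeral)
      also have "norm (g z (g s v) - g s (g s v)) \<le> 2 * (onorm (g s))\<^sup>2 * cmod (z - s) * (onorm (g s) * norm v)"
        using near(2)[OF small, of "g s v"] onorm[OF bg, of s v]
        by (meson mult_left_mono mult_nonneg_nonneg norm_ge_zero order_trans zero_le_numeral zero_le_power2)
      finally have "norm (H z - H s) \<le> 6 * onorm (g s) ^ 3 * norm v * cmod (z - s)"
        by (simp add: power2_eq_square power3_eq_cube algebra_simps)
      also have "\<dots> \<le> ?C * cmod (z - s)"
        by (intro mult_right_mono) (auto intro: onorm_pos_le[OF bg])
      finally show ?thesis .
    qed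
    have "((\<lambda>z. ?C * cmod (z - s)) \<longlongrightarrow> ?C * cmod (s - s)) (at s)"
      by (intro tendsto_intros)
    then have C0: "((\<lambda>z. ?C * cmod (z - s)) \<longlongrightarrow> 0) (at s)" by simp
    have "((\<lambda>z. H z - H s) \<longlongrightarrow> 0) (at s)"
      by (rule Lim_null_comparison[OF _ C0]) (use nearby[of s] est in \<open>auto elim!: eventually_mono\<close>)
    then show ?thesis by (simp add: isCont_def LIM_zero_iff)
  qed
  then have contH: "continuous_on UNIV H" by (simp add: continuous_at_imp_continuous_on)
  have "(G \<longlongrightarrow> 0) at_infinity"
  proof (rule Lim_null_comparison)
    have "norm (G z) \<le> norm v / (cmod z - onorm T)" if "cmod z > onorm T" for z
    proof -
      have "cmod z * norm (G z) = norm (v + T (G z))"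
        using inv(2)[of z v] by (simp add: G_def diff_eq_eq flip: norm_cs)
      also have "\<dots> \<le> norm v + onorm T * norm (G z)"
        using norm_triangle_ineq[of v "T (G z)"] onorm[OF T, of "G z"] by linarith
      finally show ?thesis using that by (simp add: field_simps)
    qed
    then show "\<forall>\<^sub>F z in at_infinity. norm (G z) \<le> norm v / (cmod z - onorm T)"
      unfolding eventually_at_infinity by (intro exI[of _ "onorm T + 1"]) auto
    show "((\<lambda>z. norm v / (cmod z - onorm T)) \<longlongrightarrow> 0) at_infinity"
      by (intro tendsto_divide_0[OF tendsto_const] filterlim_at_top_imp_at_infinity)
        (simp add: filterlim_tendsto_add_at_top[OF tendsto_const filterlim_norm_at_top, of "- onorm T", simplified])
  qed
  then have "G 0 = 0" by (rule entire_vanishing_at_infinity[OF der contH])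
  \<comment> \<open>At z = 0 the resolvent equation reads - T (G 0) = v.\<close>
  then have "v = 0"
    using inv(2)[of 0 v] bounded_linear.linear[OF T] by (simp add: G_def linear_0 cs.zero_left)
  with v(2) show False by contradiction
qed

end

section \<open>The slice of a bimodule at an imaginary unit\<close>

lemma oone_norm: "norm oone = 1"
  by (simp add: oone_def norm_prod_def)

text \<open>By the quadratic equation \<open>omult_self\<close>, a root of -1 with nonzero real part
  would be a real multiple of 1, whose square cannot be -1.\<close>

lemma imag_unit_iff: "J \<in> \<S> \<longleftrightarrow> re J = 0 \<and> norm J = 1"
proof
  assume "J \<in> \<S>"
  then have eq: "(2 * re J) *\<^sub>R J - (norm J)\<^sup>2 *\<^sub>R oone = - oone"
    using omult_self[of J] by (simp add: imag_units_def)
  have "re ((2 * re J) *\<^sub>R J - (norm J)\<^sup>2 *\<^sub>R oone) = re (- oone)"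
    unfolding eq ..
  then have r: "2 * (re J)\<^sup>2 - (norm J)\<^sup>2 = - 1"
    by (simp add: oone_def power2_eq_square)
  show "re J = 0 \<and> norm J = 1"
  proof (cases "re J = 0")
    case True
    with r show ?thesis by (simp add: power2_eq_1_iff) (use norm_ge_zero[of J] in linarith)
  next
    case False
    have "(2 * re J) *\<^sub>R J = ((norm J)\<^sup>2 - 1) *\<^sub>R oone"
      using eq by (simp add: algebra_simps)
    also have "\<dots> = (2 * re J) *\<^sub>R (re J *\<^sub>R oone)"
      using r by (simp add: power2_eq_square)
    finally have "J = re J *\<^sub>R oone" using False by (simp only: scaleR_cancel_left) simp
    then have "norm J = \<bar>re J\<bar>" by (metis mult.right_neutral norm_scaleR oone_norm)
    with r have "(re J)\<^sup>2 = - 1" by simp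
    then show ?thesis by (smt (verit) zero_le_power2)
  qed
next
  assume "re J = 0 \<and> norm J = 1"
  then show "J \<in> \<S>" by (simp add: imag_units_def omult_self)
qed

lemma slice_cover: "\<exists>J\<in>\<S>. s \<in> CJ J"
proof -
  define u where "u = s - re s *\<^sub>R oone"
  have u: "re u = 0" "s = re s *\<^sub>R oone + 1 *\<^sub>R u" by (simp_all add: u_def oone_def)
  show ?thesis
  proof (cases "u = 0")
    case True
    \<comment> \<open>A real s lies in every slice; \<open>oe 1\<close> is an arbitrary
      choice.\<close>
    have "oe 1 \<in> \<S>" by (simp add: imag_unit_iff oe_def norm_prod_def)
    moreover have "s = re s *\<^sub>R oone + 0 *\<^sub>R oe 1" using u(2) True by simp
    ultimately show ?thesis unfolding CJ_def by blast
  next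
    case False
    then have "u /\<^sub>R norm u \<in> \<S>" using u(1) by (simp add: imag_unit_iff)
    moreover have "s = re s *\<^sub>R oone + norm u *\<^sub>R (u /\<^sub>R norm u)" using u(2) False by simp
    ultimately show ?thesis unfolding CJ_def by blast
  qed
qed

locale octonion_slice = oct_bimodule lm rm
  for lm :: "oct \<Rightarrow> 'v::banach \<Rightarrow> 'v" and rm :: "'v \<Rightarrow> oct \<Rightarrow> 'v" +
  fixes J :: oct
  assumes norm_rm: "norm (rm x p) = norm p * norm x" and J: "J \<in> \<S>"
begin

text \<open>Identifies the complex numbers with C_J, sending i to J, so that spectra can be studied
  in the complex plane and carried over.\<close>

definition emb :: "complex \<Rightarrow> oct" where
  "emb z = Re z *\<^sub>R oone + Im z *\<^sub>R J"

lemma norm_emb: "norm (emb z) = cmod z"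
proof -
  have "inner oone J = 0"
    using J by (cases J) (auto simp: imag_unit_iff oone_def inner_complex_def)
  moreover from this have "inner J oone = 0" by (simp add: inner_commute[of J oone])
  ultimately have "(norm (emb z))\<^sup>2 = (Re z)\<^sup>2 * (norm oone)\<^sup>2 + (Im z)\<^sup>2 * (norm J)\<^sup>2"
    unfolding emb_def power2_norm_eq_inner
    by (simp add: inner_add_left inner_add_right power2_eq_square)
  also have "\<dots> = (cmod z)\<^sup>2"
    using J by (simp add: imag_unit_iff oone_norm cmod_power2)
  finally show ?thesis by (simp add: power2_eq_iff_nonneg)
qed

lemma rm_emb: "rm x (emb z) = Re z *\<^sub>R x + Im z *\<^sub>R rm x J"
  by (simp add: emb_def oone_eq)

sublocale complex_structure "\<lambda>x. rm x J"
proof (rule complex_structure.intro)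
  show "linear (\<lambda>x. rm x J)" by (rule linearI; simp)
  show "rm (rm x J) J = - x" for x
    using J by (simp add: rm_rm_same imag_units_def oone_eq)
  show "norm (Re z *\<^sub>R x + Im z *\<^sub>R rm x J) = cmod z * norm x" for z x
    by (simp add: norm_rm norm_emb flip: rm_emb)
qed

lemma rm_emb_eq_cs: "rm x (emb z) = cs z x"
  by (simp add: rm_emb cs_def)

lemma CJ_eq: "CJ J = range emb"
proof (rule set_eqI)
  fix c
  have "a *\<^sub>R oone + b *\<^sub>R J = emb (Complex a b)" for a b by (simp add: emb_def)
  then have "c \<in> CJ J \<longleftrightarrow> (\<exists>a b. c = emb (Complex a b))"
    by (simp only: CJ_def mem_Collect_eq simp_thms)
  also have "\<dots> \<longleftrightarrow> c \<in> range emb"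
    by (metis complex.exhaust rangeE rangeI)
  finally show "c \<in> CJ J \<longleftrightarrow> c \<in> range emb" .
qed

lemma inj_emb: "inj emb"
proof (rule injI)
  fix z w assume "emb z = emb w"
  then have "emb (z - w) = 0" by (simp add: emb_def algebra_simps)
  then show "z = w" using norm_emb[of "z - w"] by simp
qed

text \<open>Powers of g are real linear, so commuting with all scalars in C_J reduces to commuting
  with J. The exponent 0, present only in the commutant, is trivial.\<close>

lemma CJ_ext_pa_iff:
  assumes "bounded_linear g"
  shows "CJ_ext_pa lm rm J g \<longleftrightarrow> ReM lm rm \<subseteq> K_power_commutant g"
proof
  assume ext: "CJ_ext_pa lm rm J g"
  have "J = emb \<i>" by (simp add: emb_def)
  then have "J \<in> CJ J" by (simp add: CJ_eq)
  then have "(g ^^ n) (rm v J) = rm ((g ^^ n) v) J" if "v \<in> ReM lm rm" for n v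
    using ext that by (cases "n = 0") (simp_all add: CJ_ext_pa_def)
  then show "ReM lm rm \<subseteq> K_power_commutant g" by (auto simp: K_power_commutant_def)
next
  assume sub: "ReM lm rm \<subseteq> K_power_commutant g"
  show "CJ_ext_pa lm rm J g"
    unfolding CJ_ext_pa_def CJ_eq
  proof (intro allI impI ballI)
    fix n v c assume v: "v \<in> ReM lm rm" and "c \<in> range emb"
    then obtain z where c: "c = emb z" by blast
    have "(g ^^ n) (rm v J) = rm ((g ^^ n) v) J"
      using v sub by (auto simp: K_power_commutant_def)
    then show "(g ^^ n) (rm v c) = rm ((g ^^ n) v) c"
      by (simp add: c rm_emb_eq_cs cs_commute linear_funpow[OF assms])
  qed
qed

lemma rho_J_eq:
  assumes "bounded_linear T"
  shows "rho_J lm rm J T = emb ` {z. \<exists>g. resolvent_on (ReM lm rm) T z g}"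
proof -
  have "bounded_linear (\<lambda>v. rm v (emb z) - T v)" for z
    unfolding rm_emb_eq_cs by (intro bounded_linear_sub cs.bounded_linear_right assms)
  then have "emb z \<in> rho_J lm rm J T \<longleftrightarrow> (\<exists>g. resolvent_on (ReM lm rm) T z g)" for z
    unfolding rho_J_def resolvent_on_def
    by (auto simp: CJ_eq fun_eq_iff rm_emb_eq_cs CJ_ext_pa_iff)
  moreover have "rho_J lm rm J T \<subseteq> range emb" by (auto simp: rho_J_def CJ_eq)
  ultimately show ?thesis by auto
qed

lemma power_assoc_op_K_power_commutant:
  assumes "power_assoc_op lm rm T"
  shows "ReM lm rm \<subseteq> K_power_commutant T"
  using assms
  by (auto simp: power_assoc_op_def B_RO_def K_power_commutant_def
      intro!: para_linear_on_ReM bounded_linear.linear)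

lemma norm_gt_in_rho_J:
  assumes "power_assoc_op lm rm T" "bounded_linear T" "s \<in> CJ J" "onorm T < norm s"
  shows "s \<in> rho_J lm rm J T"
  using assms resolvent_outside_norm_ball[OF assms(2) power_assoc_op_K_power_commutant[OF assms(1)]]
  by (auto simp: CJ_eq rho_J_eq norm_emb)

lemma sigma_J_compact_nonempty:
  assumes pa: "power_assoc_op lm rm T" and T: "bounded_linear T" and "\<exists>v::'v. v \<noteq> 0"
  shows "compact (sigma_J lm rm J T)" "sigma_J lm rm J T \<noteq> {}"
proof -
  let ?S = "- {z. \<exists>g. resolvent_on (ReM lm rm) T z g}"
  have eq: "sigma_J lm rm J T = emb ` ?S"
    unfolding sigma_J_def rho_J_eq[OF T] CJ_eq
    by (simp add: image_set_diff[OF inj_emb, symmetric] Compl_eq_Diff_UNIV)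
  have "?S \<subseteq> cball 0 (onorm T)"
    using resolvent_outside_norm_ball[OF T power_assoc_op_K_power_commutant[OF pa]]
    by (auto simp: not_less[symmetric])
  then have "compact ?S"
    by (metis bounded_cball bounded_subset closed_Compl compact_eq_bounded_closed open_resolvent_set)
  moreover have "continuous_on ?S emb"
    unfolding emb_def by (intro continuous_intros)
  ultimately show "compact (sigma_J lm rm J T)"
    unfolding eq by (rule compact_continuous_image[rotated])
  obtain v where "v \<in> ReM lm rm" "v \<noteq> 0"
    using ReM_nontrivial assms(3) by blast
  from resolvent_set_not_UNIV[OF T this] show "sigma_J lm rm J T \<noteq> {}"
    unfolding eq by blast
qed

end

theorem mainTheorem10:
  fixes lm :: "oct \<Rightarrow> 'v::banach \<Rightarrow> 'v" and rm :: "'v \<Rightarrow> oct \<Rightarrow> 'v"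
    and T :: "'v \<Rightarrow> 'v"
  assumes "banach_O_bimodule lm rm"
    and "\<exists>v::'v. v \<noteq> 0"
    and "B_RO lm rm T"
    and "power_assoc_op lm rm T"
  shows "(\<forall>s. norm s > onorm T \<longrightarrow>
            s \<in> rho_star lm rm T \<and> (\<forall>J\<in>\<S>. s \<in> CJ J \<longrightarrow> s \<in> rho_J lm rm J T))
       \<and> (\<forall>J\<in>\<S>. sigma_J lm rm J T \<noteq> {} \<and> compact (sigma_J lm rm J T)
                 \<and> sigma_J lm rm J T \<subseteq> CJ J)"
proof -
  have T: "bounded_linear T" using assms(3) by (simp add: B_RO_def)
  have slice: "octonion_slice lm rm J" if "J \<in> \<S>" for J
    using assms(1) that
    by (simp add: octonion_slice_def octonion_slice_axioms_def oct_bimodule_def banach_O_bimodule_def)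
  have outside: "s \<in> rho_J lm rm J T" if "onorm T < norm s" "J \<in> \<S>" "s \<in> CJ J" for s J
    by (rule octonion_slice.norm_gt_in_rho_J[OF slice[OF that(2)] assms(4) T that(3,1)])
  \<comment> \<open>Every octonion lies in some slice, so the bound for single slices yields the
    union.\<close>
  moreover have "s \<in> rho_star lm rm T" if "onorm T < norm s" for s
    using slice_cover[of s] outside[OF that] unfolding rho_star_def by blast
  ultimately show ?thesis
    using octonion_slice.sigma_J_compact_nonempty[OF slice assms(4) T assms(2)]
    by (auto simp: sigma_J_def)
qed

end
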